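(* Let $\mathbb{P}$ be a strong Rayleigh probability measure on $\mathcal{B}_n=\{0,1\}^n$, let $N(\omega)=\sum_{j=1}^n\omega_j$, and let $\mu=\mathbb{E}N$. Let $f:\mathcal{B}_n\to\mathbb{R}$ be Lipschitz-1. Then for every real $a>0$, $$\mathbb{P}(f-\mathbb{E}f>a)\le 3\exp\left(-\frac{a^2}{16(a+2\mu)}\right)$$ and $$\mathbb{P}(|f-\mathbb{E}f|>a)\le 5\exp\left(-\frac{a^2}{16(a+2\mu)}\right).$$
   Context: A probability measure $\mathbb{P}$ on $\{0,1\}^n$ is strong Rayleigh if its generating polynomial $\sum_{\omega\in\{0,1\}^n}\mathbb{P}(\omega)\prod_{j=1}^n z_j^{\omega_j}$ has no zero $(z_1,\dots,z_n)\in\mathbb{C}^n$ all of whose coordinates lie in the open upper half plane. A function $f$ on $\{0,1\}^n$ is Lipschitz-1 if $|f(x)-f(x')|\le 1$ whenever $x,x'$ differ in exactly one coordinate. *)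

theory Defs
  imports "HOL-Probability.Probability"
begin

text \<open>A configuration in \<open>{0,1}^n\<close> is an extensional function on the index set \<open>{1..n}\<close>;
  a probability measure on \<open>{0,1}^n\<close> is a \<open>pmf\<close> whose support lies in \<open>cube n\<close>.\<close>

definition cube :: "nat \<Rightarrow> (nat \<Rightarrow> nat) set" where
  "cube n = {1..n} \<rightarrow>\<^sub>E {0, 1}"

definition gen_poly :: "nat \<Rightarrow> (nat \<Rightarrow> nat) pmf \<Rightarrow> (nat \<Rightarrow> complex) \<Rightarrow> complex" where
  "gen_poly n P z = (\<Sum>\<omega>\<in>cube n. complex_of_real (pmf P \<omega>) * (\<Prod>j=1..n. z j ^ \<omega> j))"

definition strong_rayleigh :: "nat \<Rightarrow> (nat \<Rightarrow> nat) pmf \<Rightarrow> bool" where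
  "strong_rayleigh n P \<longleftrightarrow>
     \<not> (\<exists>z. (\<forall>j\<in>{1..n}. Im (z j) > 0) \<and> gen_poly n P z = 0)"

definition lipschitz1 :: "nat \<Rightarrow> ((nat \<Rightarrow> nat) \<Rightarrow> real) \<Rightarrow> bool" where
  "lipschitz1 n f \<longleftrightarrow>
     (\<forall>x\<in>cube n. \<forall>x'\<in>cube n.
        (\<exists>!j. j \<in> {1..n} \<and> x j \<noteq> x' j) \<longrightarrow> \<bar>f x - f x'\<bar> \<le> 1)"

end

theory Submission
  imports Defs "HOL-Computational_Algebra.Fundamental_Theorem_Algebra"
begin

text \<open>Follow Pemantle and Peres, with exponential moments in place of the truncation of \<open>N\<close>.
  After a small independent perturbation all weights are positive. Moving \<open>x + \<i>y\<close> linearly from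
  \<open>\<i>y\<close>, no root of \<open>s \<mapsto> p (s (x + \<i>y))\<close> can cross the real axis, so all roots stay in the upper
  half plane; by Gauss--Lucas every homogeneous part of \<open>p\<close> is again stable, and hence pairwise
  negatively correlated under all conditionings. The Feder--Mihail argument then shows that
  conditioning on \<open>i\<close> being absent stochastically increases the rest of a homogeneous measure.
  If \<open>f\<close> is Lipschitz-1, then \<open>\<plusminus>f + N\<close> is increasing; applied to these functions, stochastic
  domination bounds all differences of conditional means without constructing a coupling. Given
  \<open>N = k\<close>, revealing the \<open>k\<close> ones in random order is a martingale with increments at most \<open>2\<close>.
  Finally \<open>N\<close> is a sum of independent Bernoulli variables and \<open>k \<mapsto> E(f | N = k)\<close> is Lipschitz-1.
  Altogether \<open>E exp (\<lambda> (f - Ef)) \<le> exp (7 \<lambda>\<^sup>2 \<mu>)\<close> for \<open>\<bar>\<lambda>\<bar> \<le> 1/8\<close>, and \<open>\<lambda> = a / (8 (a + 2 \<mu>))\<close> gives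
  the one-sided bound even with constant \<open>1\<close>.\<close>


section \<open>Roots of complex polynomials and the upper half plane\<close>

text \<open>Every linear factor has modulus at least \<open>d\<close> at \<open>s\<close>. Read
  backwards it locates roots: a value at \<open>s\<close> that is small against the leading
  coefficient forces a root at distance less than \<open>d\<close>, which serves as quantitative
  continuity of roots.\<close>

lemma norm_poly_ge_dist_roots:
  fixes p :: "complex poly"
  assumes "\<And>r. poly p r = 0 \<Longrightarrow> d \<le> norm (s - r)" "0 \<le> d"
  shows "norm (lead_coeff p) * d ^ degree p \<le> norm (poly p s)"
proof -
  obtain root where root: "smult (lead_coeff p) (\<Prod>i<degree p. [:-root i, 1:]) = p"
    using complex_poly_decompose' by blast
  have ev: "poly p x = lead_coeff p * (\<Prod>i<degree p. x - root i)" for x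
    by (subst root[symmetric]) (simp add: poly_prod)
  have "d \<le> norm (s - root i)" if "i < degree p" for i
  proof (rule assms(1))
    show "poly p (root i) = 0" using that by (auto simp: ev intro!: prod_zero)
  qed
  then have "(\<Prod>i<degree p. d) \<le> (\<Prod>i<degree p. norm (s - root i))"
    by (intro prod_mono) (use assms in auto)
  then show ?thesis
    unfolding ev by (simp add: norm_mult prod_norm mult_left_mono)
qed

text \<open>The logarithmic derivative is the sum of \<open>inverse (s - root i)\<close>. If
  \<open>Im s \<le> 0\<close>, every \<open>s - root i\<close> lies in the open lower half plane, so
  all inverses have positive imaginary part and their sum cannot vanish.\<close>

lemma Gauss_Lucas_upper_half_plane:
  fixes p :: "complex poly"
  assumes roots: "\<And>r. poly p r = 0 \<Longrightarrow> Im r > 0" and "degree p > 0" and "poly (pderiv p) s = 0"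
  shows "Im s > 0"
proof (rule ccontr)
  assume "\<not> Im s > 0"
  then have s: "Im s \<le> 0" by simp
  obtain root where root: "smult (lead_coeff p) (\<Prod>i<degree p. [:-root i, 1:]) = p"
    using complex_poly_decompose' by blast
  have ev: "poly p x = lead_coeff p * (\<Prod>i<degree p. x - root i)" for x
    by (subst root[symmetric]) (simp add: poly_prod)
  have im: "Im (root i) > 0" if "i < degree p" for i
    by (rule roots) (use that in \<open>auto simp: ev intro!: prod_zero\<close>)
  then have ne: "s - root i \<noteq> 0" if "i < degree p" for i using that s by fastforce
  have "poly (pderiv p) s = lead_coeff p * (\<Sum>i<degree p. \<Prod>j\<in>{..<degree p} - {i}. s - root j)"
    by (subst root[symmetric], subst pderiv_smult, subst pderiv_prod)
      (simp add: poly_sum poly_prod pderiv_pCons)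
  also have "(\<Sum>i<degree p. \<Prod>j\<in>{..<degree p} - {i}. s - root j) =
     (\<Sum>i<degree p. (\<Prod>j<degree p. s - root j) * inverse (s - root i))"
  proof (rule sum.cong)
    fix i assume i: "i \<in> {..<degree p}"
    have "(\<Prod>j<degree p. s - root j) = (s - root i) * (\<Prod>j\<in>{..<degree p} - {i}. s - root j)"
      by (rule prod.remove) (use i in auto)
    then show "(\<Prod>j\<in>{..<degree p} - {i}. s - root j) = (\<Prod>j<degree p. s - root j) * inverse (s - root i)"
      using ne i by simp
  qed simp
  also have "lead_coeff p * \<dots> = poly p s * (\<Sum>i<degree p. inverse (s - root i))"
    by (simp add: ev sum_distrib_left mult_ac)
  finally have "poly p s * (\<Sum>i<degree p. inverse (s - root i)) = 0" using assms by simp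
  moreover have "poly p s \<noteq> 0" using roots s by fastforce
  moreover have "Im (\<Sum>i<degree p. inverse (s - root i)) > 0"
    unfolding Im_sum
  proof (rule sum_pos)
    fix i assume i: "i \<in> {..<degree p}"
    have "(Re s - Re (root i))\<^sup>2 + (Im s - Im (root i))\<^sup>2 > 0"
      using im[of i] s i by (intro add_nonneg_pos) auto
    then show "Im (inverse (s - root i)) > 0"
      using im[of i] s i by (simp add: zero_less_divide_iff)
  qed (use assms in auto)
  ultimately show False by auto
qed

text \<open>By Gauss--Lucas the iterated derivatives keep their roots in the upper half plane.
  Coefficient \<open>k\<close> is, up to a nonzero factor, the value of the \<open>k\<close>-th
  derivative at 0, and 0 is not a root.\<close>

lemma coeff_nonzero_if_roots_upper_half_plane:
  fixes p :: "complex poly"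
  assumes "\<And>r. poly p r = 0 \<Longrightarrow> Im r > 0" "k \<le> degree p"
  shows "coeff p k \<noteq> 0"
  using assms
proof (induction k arbitrary: p)
  case 0
  show ?case using 0(1)[of 0] by (auto simp: poly_0_coeff_0)
next
  case (Suc k)
  have "Im r > 0" if "poly (pderiv p) r = 0" for r
    using Gauss_Lucas_upper_half_plane[OF Suc.prems(1) _ that] Suc.prems(2) by auto
  then have "coeff (pderiv p) k \<noteq> 0"
    using Suc.prems(2) by (intro Suc.IH) (auto simp: degree_pderiv)
  then show ?case by (simp add: coeff_pderiv)
qed

text \<open>Roots depend continuously on the parameter and cannot cross the real axis.\<close>

lemma no_roots_lower_half_plane_persists:
  fixes p :: "real \<Rightarrow> complex poly"
  assumes deg: "\<And>t. t \<in> {0..1} \<Longrightarrow> degree (p t) = n"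
    and cont: "\<And>k. continuous_on {0..1} (\<lambda>t. coeff (p t) k)"
    and real: "\<And>t r. t \<in> {0..1} \<Longrightarrow> poly (p t) r = 0 \<Longrightarrow> Im r \<noteq> 0"
    and init: "\<And>r. poly (p 0) r = 0 \<Longrightarrow> Im r \<ge> 0"
    and t: "t \<in> {0..1}" and root: "poly (p t) r = 0"
  shows "Im r > 0"
proof (rule ccontr)
  assume "\<not> Im r > 0"
  then have r: "Im r < 0" using real[OF t root] by linarith
  define I :: "real set" where "I = {0..1}"
  \<comment> \<open>The bad parameters: \<open>B\<close> is shown to be open and closed in the
    connected interval, and it misses 0.\<close>
  define B where "B = {t\<in>I. \<exists>s. Im s < 0 \<and> poly (p t) s = 0}"
  \<comment> \<open>The zero polynomial would have the real root 0, so constant degree makes the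
    leading coefficient nonzero throughout.\<close>
  have lc: "coeff (p t) n \<noteq> 0" if "t \<in> I" for t
  proof (cases "p t = 0")
    case True
    then have "poly (p t) 0 = 0" by simp
    then show ?thesis using real[of t 0] that unfolding I_def by auto
  next
    case False
    then show ?thesis using deg[of t] that unfolding I_def by (metis leading_coeff_0_iff)
  qed
  have ev: "poly (p t) s = (\<Sum>k\<le>n. coeff (p t) k * s ^ k)" if "t \<in> I" for t s
    using deg[of t] that by (simp add: poly_altdef I_def)
  \<comment> \<open>For parameters near \<open>t\<close> the value at \<open>s\<close> stays below
    the leading coefficient times \<open>(- Im s) ^ n\<close> in modulus, so some root lies within
    \<open>- Im s\<close> of \<open>s\<close>, a disc inside the lower half plane.\<close>
  have "openin (top_of_set I) B"
    unfolding openin_contains_ball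
  proof (intro conjI ballI)
    fix t assume "t \<in> B"
    then obtain s where t: "t \<in> I" and s: "Im s < 0" "poly (p t) s = 0" unfolding B_def by auto
    have "continuous_on I (\<lambda>u. norm (coeff (p u) n) * (- Im s) ^ n - norm (\<Sum>k\<le>n. coeff (p u) k * s ^ k))"
      unfolding I_def by (intro continuous_intros cont)
    then have "continuous_on I (\<lambda>u. norm (coeff (p u) n) * (- Im s) ^ n - norm (poly (p u) s))"
      by (rule continuous_on_eq) (simp add: ev)
    then have c: "continuous (at t within I) (\<lambda>u. norm (coeff (p u) n) * (- Im s) ^ n - norm (poly (p u) s))"
      using t by (simp add: continuous_on_eq_continuous_within)
    have pos: "norm (coeff (p t) n) * (- Im s) ^ n - norm (poly (p t) s) > 0"
      using s lc[OF t] by simp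
    have "\<forall>\<^sub>F u in at t within I. norm (coeff (p u) n) * (- Im s) ^ n - norm (poly (p u) s) > 0"
      using c pos unfolding continuous_within by (intro order_tendstoD(1))
    then obtain d where d: "d > 0" and
      dd: "\<And>u. u \<in> I \<Longrightarrow> u \<noteq> t \<Longrightarrow> dist u t < d \<Longrightarrow> norm (coeff (p u) n) * (- Im s) ^ n > norm (poly (p u) s)"
      unfolding eventually_at by auto
    have "u \<in> B" if u: "u \<in> I" "dist u t < d" for u
    proof -
      have "norm (lead_coeff (p u)) * (- Im s) ^ degree (p u) > norm (poly (p u) s)"
        using dd[OF u(1) _ u(2)] pos deg[of u] u by (cases "u = t") (auto simp: I_def)
      then have "\<not> (\<forall>r. poly (p u) r = 0 \<longrightarrow> - Im s \<le> norm (s - r))"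
        using norm_poly_ge_dist_roots[of "p u" "- Im s" s] s by fastforce
      then obtain r where r: "poly (p u) r = 0" "norm (s - r) < - Im s" by force
      moreover have "Im r < 0" using r(2) abs_Im_le_cmod[of "s - r"] by simp
      ultimately show ?thesis using u unfolding B_def by auto
    qed
    then have "ball t d \<inter> I \<subseteq> B" by (auto simp: dist_commute)
    then show "\<exists>e>0. ball t e \<inter> I \<subseteq> B" using d by auto
  qed (auto simp: B_def)
  \<comment> \<open>A Cauchy bound confines all roots to one disc, so the pairs of a parameter and a
    root with \<open>Im s \<le> 0\<close> form a compact set. As real roots are excluded,
    \<open>B\<close> is its projection.\<close>
  moreover have "closedin (top_of_set I) B"
  proof -
    have "compact I" unfolding I_def by simp
    have "continuous_on I (\<lambda>t. inverse (norm (coeff (p t) n)) * (\<Sum>k<n. norm (coeff (p t) k)))"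
      unfolding I_def by (intro continuous_intros cont) (use lc in \<open>auto simp: I_def\<close>)
    then have "bounded ((\<lambda>t. inverse (norm (coeff (p t) n)) * (\<Sum>k<n. norm (coeff (p t) k))) ` I)"
      using \<open>compact I\<close> compact_continuous_image compact_imp_bounded by blast
    then obtain K where "\<forall>t\<in>I. \<bar>inverse (norm (coeff (p t) n)) * (\<Sum>k<n. norm (coeff (p t) k))\<bar> \<le> K"
      unfolding bounded_real by blast
    then have K: "inverse (norm (coeff (p t) n)) * (\<Sum>k<n. norm (coeff (p t) k)) \<le> K" if "t \<in> I" for t
      using that abs_le_D1 by blast
    have bound: "norm s \<le> max 1 K" if t: "t \<in> I" and s: "poly (p t) s = 0" for t s
    proof (cases "norm s \<le> 1")
      case False
      have "n > 0"
      proof (rule ccontr)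
        assume "\<not> n > 0"
        then show False using ev[OF t, of s] s lc[OF t] by simp
      qed
      then obtain m where m: "n = Suc m" by (cases n) auto
      have "coeff (p t) n * s ^ n = - (\<Sum>k<n. coeff (p t) k * s ^ k)"
        using ev[OF t, of s] s by (simp add: lessThan_Suc_atMost[symmetric] add_eq_0_iff)
      then have "norm (coeff (p t) n) * norm s ^ n = norm (\<Sum>k<n. coeff (p t) k * s ^ k)"
        by (metis norm_minus_cancel norm_mult norm_power)
      also have "\<dots> \<le> (\<Sum>k<n. norm (coeff (p t) k) * norm s ^ k)"
        by (rule order_trans[OF norm_sum]) (simp add: norm_mult norm_power)
      also have "\<dots> \<le> (\<Sum>k<n. norm (coeff (p t) k) * norm s ^ m)"
        using False m by (intro sum_mono mult_left_mono power_increasing) auto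
      finally have "norm (coeff (p t) n) * norm s * norm s ^ m \<le> (\<Sum>k<n. norm (coeff (p t) k)) * norm s ^ m"
        by (simp add: m sum_distrib_left mult_ac del: sum.lessThan_Suc)
      then have "norm (coeff (p t) n) * norm s \<le> (\<Sum>k<n. norm (coeff (p t) k))"
        using zero_less_power[of "norm s" m] False
        by (metis mult_le_cancel_right_pos not_le order_less_trans zero_less_one)
      then have "norm s \<le> inverse (norm (coeff (p t) n)) * (\<Sum>k<n. norm (coeff (p t) k))"
        using lc[OF t] by (simp add: field_simps)
      then show ?thesis using K[OF t] by linarith
    qed simp
    define C where "C = {x \<in> I \<times> (cball 0 (max 1 K) \<inter> {s. Im s \<le> 0}). poly (p (fst x)) (snd x) = 0}"
    have cD: "compact (I \<times> (cball (0::complex) (max 1 K) \<inter> {s. Im s \<le> 0}))"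
      by (intro compact_Times compact_Int_closed \<open>compact I\<close> compact_cball closed_halfspace_Im_le)
    have c1: "continuous_on (I \<times> (cball (0::complex) (max 1 K) \<inter> {s. Im s \<le> 0}))
        (\<lambda>x. \<Sum>k\<le>n. coeff (p (fst x)) k * snd x ^ k)"
      unfolding I_def by (intro continuous_intros continuous_on_compose2[OF cont]) auto
    have "C = {x \<in> I \<times> (cball 0 (max 1 K) \<inter> {s. Im s \<le> 0}). (\<Sum>k\<le>n. coeff (p (fst x)) k * snd x ^ k) = 0}"
      unfolding C_def using ev by auto
    then have "compact C"
      using continuous_closedin_preimage_constant[OF c1, of 0] closedin_compact[OF cD]
      by (simp add: vimage_def Int_def)
    then have "compact (fst ` C)" by (intro compact_continuous_image continuous_intros)
    moreover have "fst ` C = B"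
    proof (intro equalityI subsetI)
      fix t assume "t \<in> fst ` C"
      then obtain s where s: "t \<in> I" "Im s \<le> 0" "poly (p t) s = 0" unfolding C_def by auto
      then have "Im s < 0" using real[of t s] by (auto simp: I_def)
      then show "t \<in> B" using s unfolding B_def by auto
    next
      fix t assume "t \<in> B"
      then obtain s where s: "t \<in> I" "Im s < 0" "poly (p t) s = 0" unfolding B_def by auto
      then have "(t, s) \<in> C" using bound unfolding C_def by auto
      then show "t \<in> fst ` C" by force
    qed
    ultimately have "closed B" using compact_imp_closed by auto
    then show ?thesis unfolding closedin_closed by (intro exI[of _ B]) (auto simp: B_def)
  qed
  moreover have "connected I" unfolding I_def by simp
  ultimately have "B = {} \<or> B = I" unfolding connected_clopen by blast
  moreover have "t \<in> B" using t root r unfolding B_def I_def by auto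
  moreover have "0 \<notin> B" using init unfolding B_def by force
  ultimately show False unfolding I_def by auto
qed


section \<open>Negative dependence and the Feder--Mihail inequality\<close>

definition slice :: "'a set \<Rightarrow> nat \<Rightarrow> 'a set \<Rightarrow> 'a set \<Rightarrow> 'a set set" where
  "slice V k T U = {S. S \<subseteq> V \<and> card S = k \<and> T \<subseteq> S \<and> S \<inter> U = {}}"

text \<open>Slices encode conditioning on \<open>T\<close> present and \<open>U\<close> absent. The
  inequality is nonpositive covariance of \<open>i\<close> and \<open>j\<close> under this
  conditioning, cross-multiplied so that it also makes sense for empty slices.\<close>

definition neg_dep :: "'a set \<Rightarrow> nat \<Rightarrow> ('a set \<Rightarrow> real) \<Rightarrow> bool" where
  "neg_dep V k w \<longleftrightarrow> (\<forall>S\<subseteq>V. card S = k \<longrightarrow> w S > 0) \<and>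
     (\<forall>T U i j. T \<subseteq> V \<longrightarrow> U \<subseteq> V \<longrightarrow> T \<inter> U = {} \<longrightarrow> i \<in> V - T - U \<longrightarrow> j \<in> V - T - U \<longrightarrow> i \<noteq> j \<longrightarrow>
       sum w (slice V k (insert i (insert j T)) U) * sum w (slice V k T (insert i (insert j U)))
       \<le> sum w (slice V k (insert i T) (insert j U)) * sum w (slice V k (insert j T) (insert i U)))"

lemma finite_slice [simp]: "finite V \<Longrightarrow> finite (slice V k T U)"
  by (rule finite_subset[of _ "Pow V"]) (auto simp: slice_def)

lemma sum_slice_split:
  fixes h :: "'a set \<Rightarrow> real"
  assumes "finite V"
  shows "sum h (slice V k T U) = sum h (slice V k (insert j T) U) + sum h (slice V k T (insert j U))"
proof -
  have "slice V k T U = slice V k (insert j T) U \<union> slice V k T (insert j U)"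
    by (auto simp: slice_def)
  moreover have "slice V k (insert j T) U \<inter> slice V k T (insert j U) = {}"
    by (auto simp: slice_def)
  ultimately show ?thesis using assms by (simp add: sum.union_disjoint)
qed

text \<open>Each \<open>S\<close> in the slice is counted once for each of its
  \<open>k - card T\<close> elements outside \<open>T\<close>. This factor does not depend on
  \<open>S\<close>, which is how homogeneity enters the correlation argument and the random-order
  martingale.\<close>

lemma sum_slice_double_count:
  fixes h :: "'a set \<Rightarrow> real"
  assumes "finite V" "T \<subseteq> V" "T \<inter> U = {}"
  shows "(\<Sum>j\<in>V - T - U. sum h (slice V k (insert j T) U)) = (real k - real (card T)) * sum h (slice V k T U)"
proof -
  have "(\<Sum>j\<in>V - T - U. sum h (slice V k (insert j T) U)) =
        (\<Sum>j\<in>V - T - U. \<Sum>S\<in>slice V k T U. if j \<in> S then h S else 0)"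
  proof (rule sum.cong)
    fix j assume j: "j \<in> V - T - U"
    have "slice V k (insert j T) U = slice V k T U \<inter> {S. j \<in> S}" by (auto simp: slice_def)
    then show "sum h (slice V k (insert j T) U) = (\<Sum>S\<in>slice V k T U. if j \<in> S then h S else 0)"
      using assms by (simp add: sum.inter_restrict)
  qed simp
  also have "\<dots> = (\<Sum>S\<in>slice V k T U. \<Sum>j\<in>V - T - U. if j \<in> S then h S else 0)"
    by (rule sum.swap)
  also have "\<dots> = (\<Sum>S\<in>slice V k T U. (real k - real (card T)) * h S)"
  proof (rule sum.cong)
    fix S assume S: "S \<in> slice V k T U"
    have fin: "finite S" using S assms finite_subset by (auto simp: slice_def)
    have "(\<Sum>j\<in>V - T - U. if j \<in> S then h S else 0) = (\<Sum>j\<in>(V - T - U) \<inter> S. h S)"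
      by (rule sum.inter_restrict[symmetric]) (use assms in auto)
    also have "(V - T - U) \<inter> S = S - T" using S by (auto simp: slice_def)
    also have "(\<Sum>j\<in>S - T. h S) = real (card (S - T)) * h S" by simp
    also have "card (S - T) = k - card T" "card T \<le> k"
      using S fin card_Diff_subset[of T S] card_mono[of S T] finite_subset[of T S] by (auto simp: slice_def)
    ultimately show "(\<Sum>j\<in>V - T - U. if j \<in> S then h S else 0) = (real k - real (card T)) * h S"
      by (simp add: of_nat_diff)
  qed simp
  finally show ?thesis by (simp add: sum_distrib_left)
qed

lemma slice_nonempty:
  assumes "finite V" "T \<subseteq> V" "U \<subseteq> V" "T \<inter> U = {}" "card T \<le> k" "k \<le> card (V - U)"
  shows "slice V k T U \<noteq> {}"
proof -
  have "finite T" by (rule finite_subset[OF assms(2,1)])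
  have "card (V - U - T) = card (V - U) - card T"
    using assms \<open>finite T\<close> by (intro card_Diff_subset) auto
  then obtain S where S: "S \<subseteq> V - U - T" "card S = k - card T"
    using assms obtain_subset_with_card_n[of "k - card T" "V - U - T"] by (metis diff_le_mono)
  then have "finite S" using assms finite_subset by (metis finite_Diff)
  then have "card (S \<union> T) = k" using S assms \<open>finite T\<close> by (subst card_Un_disjoint) auto
  then have "S \<union> T \<in> slice V k T U" using S assms by (auto simp: slice_def)
  then show ?thesis by auto
qed

lemma neg_dep_sum_nonneg: "neg_dep V k w \<Longrightarrow> sum w (slice V k T U) \<ge> 0"
  unfolding neg_dep_def slice_def by (intro sum_nonneg) (auto intro: less_imp_le)

lemma neg_dep_sum_pos:
  assumes "neg_dep V k w" "finite V" "T \<subseteq> V" "U \<subseteq> V" "T \<inter> U = {}" "card T \<le> k" "k \<le> card (V - U)"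
  shows "sum w (slice V k T U) > 0"
  using slice_nonempty[OF assms(2-)] assms(1,2)
  by (intro sum_pos) (auto simp: neg_dep_def slice_def)

text \<open>The \<open>z\<close> are the masses and the \<open>e\<close> the \<open>F\<close>-weighted masses of the four cells cut out by the
  coordinates \<open>i\<close> (first index) and \<open>j\<close> (second index).\<close>

lemma four_cell_inequality:
  fixes z11 z10 z01 z00 e11 e10 e01 e00 :: real
  assumes pos: "z11 > 0" "z10 > 0" "z01 > 0" "z00 > 0"
    and corr: "z11 * z00 \<le> z10 * z01"
    and j: "e11 * z10 \<ge> e10 * z11"
    and one: "e11 * z01 \<le> e01 * z11" and zero: "e10 * z00 \<le> e00 * z10"
  shows "(e11 + e10) * (z01 + z00) \<le> (e01 + e00) * (z11 + z10)"
proof -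
  \<comment> \<open>Conditional means of \<open>F\<close> on the two cells with \<open>i\<close>
    present. After \<open>e01\<close> and \<open>e00\<close> are replaced by their lower bounds
    \<open>a * z01\<close> and \<open>b * z00\<close>, the defect factors into the difference of the
    means times the correlation of \<open>i\<close> and \<open>j\<close>.\<close>
  define a b where "a = e11 / z11" and "b = e10 / z10"
  have e: "e11 = a * z11" "e10 = b * z10" using pos by (auto simp: a_def b_def)
  have "b \<le> a" using j pos by (simp add: a_def b_def field_simps)
  have "a * z01 \<le> e01" "b * z00 \<le> e00"
    using one zero pos by (auto simp: a_def b_def field_simps)
  then have "(a * z01 + b * z00) * (z11 + z10) \<le> (e01 + e00) * (z11 + z10)"
    using pos by (intro mult_right_mono) auto
  moreover have "(e11 + e10) * (z01 + z00) - (a * z01 + b * z00) * (z11 + z10) = (a - b) * (z11 * z00 - z10 * z01)"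
    unfolding e by (simp add: algebra_simps)
  moreover have "(a - b) * (z11 * z00 - z10 * z01) \<le> 0"
    using corr \<open>b \<le> a\<close> by (intro mult_nonneg_nonpos) auto
  ultimately show ?thesis by linarith
qed

text \<open>The argument of Feder and Mihail: on a homogeneous weight the covariances of \<open>F\<close> with the
  coordinates sum to zero, so some coordinate \<open>j\<close> is nonnegatively correlated with \<open>F\<close>; split along \<open>j\<close>.\<close>

lemma Feder_Mihail:
  fixes F :: "'a set \<Rightarrow> real"
  assumes nd: "neg_dep V k w" and V: "finite V"
    and mono: "\<And>A B. A \<subseteq> B \<Longrightarrow> B \<subseteq> V \<Longrightarrow> F A \<le> F B"
    and indep: "\<And>S. S \<subseteq> V \<Longrightarrow> F (insert i S) = F S"
    and "T \<subseteq> V" "U \<subseteq> V" "T \<inter> U = {}" "i \<in> V - T - U"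
  shows "(\<Sum>S\<in>slice V k (insert i T) U. w S * F S) * sum w (slice V k T (insert i U))
       \<le> (\<Sum>S\<in>slice V k T (insert i U). w S * F S) * sum w (slice V k (insert i T) U)"
  using assms(5-)
proof (induction "card (V - T - U)" arbitrary: T U rule: less_induct)
  case less
  note sub = less.prems
  define Z where "Z T U = sum w (slice V k T U)" for T U
  define E where "E T U = (\<Sum>S\<in>slice V k T U. w S * F S)" for T U
  have iV: "insert i T \<subseteq> V" "insert i U \<subseteq> V" "insert i T \<inter> U = {}" "T \<inter> insert i U = {}"
    using sub by auto
  have fin: "finite T" "finite U" using sub V finite_subset by auto
  have cT: "card (insert i T) = Suc (card T)" using sub fin by simp
  have wpos: "w S > 0" if "S \<in> slice V k A B" for S A B
    using that nd by (auto simp: neg_dep_def slice_def)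
  have cV: "card (V - insert i U) = card (V - U) - 1" "card (V - U) > 0"
  proof -
    have "V - insert i U = (V - U) - {i}" by auto
    then show "card (V - insert i U) = card (V - U) - 1" using sub V by simp
    show "card (V - U) > 0" using sub V by (auto simp: card_gt_0_iff)
  qed
  have "E (insert i T) U * Z T (insert i U) \<le> E T (insert i U) * Z (insert i T) U"
  \<comment> \<open>This condition makes all four cells nonempty. Otherwise the slice with
    \<open>i\<close> present or the one with \<open>i\<close> absent is empty or a single set, on
    which \<open>F\<close> takes its least or its greatest relevant value.\<close>
  proof (cases "card T + 2 \<le> k \<and> k + 2 \<le> card (V - U)")
    case False
    then consider "k \<le> card T" | "k = card T + 1" | "k + 1 = card (V - U)" | "k \<ge> card (V - U)" by linarith
    then show ?thesis
    proof cases
      case 1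
      have "slice V k (insert i T) U = {}"
      proof (rule ccontr)
        assume "slice V k (insert i T) U \<noteq> {}"
        then obtain S where "S \<subseteq> V" "card S = k" "insert i T \<subseteq> S" by (auto simp: slice_def)
        then show False using 1 cT card_mono[of S "insert i T"] V finite_subset by fastforce
      qed
      then show ?thesis by (simp add: E_def Z_def)
    next
      case 2
      have "F S = F T" if "S \<in> slice V k (insert i T) U" for S
      proof -
        have "insert i T = S" using that 2 cT V finite_subset
          by (intro card_subset_eq) (auto simp: slice_def)
        then show ?thesis using indep sub by metis
      qed
      then have "E (insert i T) U = F T * Z (insert i T) U"
        by (simp add: E_def Z_def sum_distrib_left mult.commute)
      moreover have "F T * Z T (insert i U) \<le> E T (insert i U)"
        unfolding E_def Z_def sum_distrib_left
      proof (rule sum_mono)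
        fix S assume S: "S \<in> slice V k T (insert i U)"
        then have "F T \<le> F S" by (intro mono) (auto simp: slice_def)
        then show "F T * w S \<le> w S * F S" using wpos[OF S] by (simp add: mult.commute)
      qed
      moreover have "Z (insert i T) U \<ge> 0" unfolding Z_def by (rule neg_dep_sum_nonneg[OF nd])
      ultimately show ?thesis using mult_right_mono[of "F T * Z T (insert i U)" "E T (insert i U)" "Z (insert i T) U"]
        by (simp add: mult_ac)
    next
      case 3
      have "F S = F (V - U)" if "S \<in> slice V k T (insert i U)" for S
      proof -
        have "S = V - insert i U" using that 3 cV V by (intro card_subset_eq) (auto simp: slice_def)
        moreover have "V - U = insert i (V - insert i U)" using sub by auto
        moreover have "V - insert i U \<subseteq> V" by auto
        ultimately show ?thesis using indep by metis
      qed
      then have "E T (insert i U) = F (V - U) * Z T (insert i U)"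
        by (simp add: E_def Z_def sum_distrib_left mult.commute)
      moreover have "E (insert i T) U \<le> F (V - U) * Z (insert i T) U"
        unfolding E_def Z_def sum_distrib_left
      proof (rule sum_mono)
        fix S assume S: "S \<in> slice V k (insert i T) U"
        then have "F S \<le> F (V - U)" by (intro mono) (auto simp: slice_def)
        then show "w S * F S \<le> F (V - U) * w S" using wpos[OF S] by (simp add: mult.commute)
      qed
      moreover have "Z T (insert i U) \<ge> 0" unfolding Z_def by (rule neg_dep_sum_nonneg[OF nd])
      ultimately show ?thesis using mult_right_mono[of "E (insert i T) U" "F (V - U) * Z (insert i T) U" "Z T (insert i U)"]
        by (simp add: mult_ac)
    next
      case 4
      have "slice V k T (insert i U) = {}"
      proof (rule ccontr)
        assume "slice V k T (insert i U) \<noteq> {}"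
        then obtain S where "S \<subseteq> V - insert i U" "card S = k" by (auto simp: slice_def)
        then show False using 4 cV card_mono[of "V - insert i U" S] V by fastforce
      qed
      then show ?thesis by (simp add: E_def Z_def)
    qed
  next
    case True
    define W where "W = V - insert i T - U"
    have Zp: "Z A B > 0" if "A \<subseteq> V" "B \<subseteq> V" "A \<inter> B = {}" "card A \<le> k" "k \<le> card (V - B)" for A B
      unfolding Z_def by (rule neg_dep_sum_pos[OF nd V that])
    have Z1: "Z (insert i T) U > 0" using True cT by (intro Zp iV sub) auto
    have dcE: "(\<Sum>j\<in>W. E (insert j (insert i T)) U) = (real k - real (card (insert i T))) * E (insert i T) U"
      unfolding E_def W_def by (rule sum_slice_double_count[OF V iV(1,3)])
    have dcZ: "(\<Sum>j\<in>W. Z (insert j (insert i T)) U) = (real k - real (card (insert i T))) * Z (insert i T) U"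
      unfolding Z_def W_def by (rule sum_slice_double_count[OF V iV(1,3)])
    \<comment> \<open>The correlation is taken given \<open>i\<close> present. Double counting gives
      the sums over \<open>j\<close> of \<open>E\<close> and of \<open>Z\<close> the same factor, so
      strict inequalities for all \<open>j\<close> would add up to a contradiction.\<close>
    have "\<exists>j\<in>W. E (insert j (insert i T)) U * Z (insert i T) U \<ge> E (insert i T) U * Z (insert j (insert i T)) U"
    proof (rule ccontr)
      assume "\<not> ?thesis"
      then have lt: "\<And>j. j \<in> W \<Longrightarrow> E (insert j (insert i T)) U * Z (insert i T) U < E (insert i T) U * Z (insert j (insert i T)) U"
        by force
      have "W \<noteq> {}"
      proof
        assume "W = {}"
        then have "(real k - real (card (insert i T))) * Z (insert i T) U = 0" using dcZ by simp
        then show False using Z1 True cT by simp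
      qed
      moreover have "finite W" using V by (simp add: W_def)
      ultimately have "(\<Sum>j\<in>W. E (insert j (insert i T)) U * Z (insert i T) U) < (\<Sum>j\<in>W. E (insert i T) U * Z (insert j (insert i T)) U)"
        by (intro sum_strict_mono lt)
      then show False
        unfolding sum_distrib_left[symmetric] sum_distrib_right[symmetric] dcE dcZ by (simp add: mult_ac)
    qed
    then obtain j where j: "j \<in> W" and
      jle: "E (insert j (insert i T)) U * Z (insert i T) U \<ge> E (insert i T) U * Z (insert j (insert i T)) U" by auto
    have jV: "j \<in> V" "j \<notin> T" "j \<notin> U" "j \<noteq> i" using j by (auto simp: W_def)
    have comm: "insert j (insert i T) = insert i (insert j T)" "insert j (insert i U) = insert i (insert j U)" by auto
    note split = sum_slice_split[OF V, of _ k _ _ j]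
    have sE: "E A B = E (insert j A) B + E A (insert j B)" for A B unfolding E_def by (rule split)
    have sZ: "Z A B = Z (insert j A) B + Z A (insert j B)" for A B unfolding Z_def by (rule split)
    have cUj: "card (V - insert j U) = card (V - U) - 1"
    proof -
      have "V - insert j U = (V - U) - {j}" by auto
      then show ?thesis using jV V by simp
    qed
    have cUij: "card (V - insert j (insert i U)) = card (V - U) - 2"
    proof -
      have "V - insert j (insert i U) = (V - insert i U) - {j}" by auto
      then show ?thesis using jV V cV by simp
    qed
    have cTj: "card (insert j T) = Suc (card T)" "card (insert j (insert i T)) = card T + 2"
      using jV fin cT sub by auto
    have IH: "E (insert i A) B * Z A (insert i B) \<le> E A (insert i B) * Z (insert i A) B"
      if "A \<subseteq> V" "B \<subseteq> V" "A \<inter> B = {}" "i \<in> V - A - B" "V - A - B = (V - T - U) - {j}" for A B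
      unfolding E_def Z_def
    proof (rule less.hyps)
      show "card (V - A - B) < card (V - T - U)"
        unfolding that(5) using jV V by (intro psubset_card_mono) auto
    qed (use that in auto)
    have "(E (insert j (insert i T)) U + E (insert i T) (insert j U)) * (Z (insert j T) (insert i U) + Z T (insert j (insert i U)))
      \<le> (E (insert j T) (insert i U) + E T (insert j (insert i U))) * (Z (insert j (insert i T)) U + Z (insert i T) (insert j U))"
    proof (rule four_cell_inequality)
      show "0 < Z (insert j (insert i T)) U" using True cTj jV sub by (intro Zp) auto
      show "0 < Z (insert i T) (insert j U)" using True cT cUj jV sub by (intro Zp) auto
      show "0 < Z (insert j T) (insert i U)" using True cTj cV jV sub by (intro Zp) auto
      show "0 < Z T (insert j (insert i U))" using True cUij jV sub by (intro Zp) auto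
      show "Z (insert j (insert i T)) U * Z T (insert j (insert i U)) \<le> Z (insert i T) (insert j U) * Z (insert j T) (insert i U)"
        using nd jV sub unfolding neg_dep_def Z_def comm by blast
      show "E (insert i T) (insert j U) * Z (insert j (insert i T)) U \<le> E (insert j (insert i T)) U * Z (insert i T) (insert j U)"
        using jle unfolding sE[of "insert i T" U] sZ[of "insert i T" U] by (simp add: algebra_simps)
      show "E (insert j (insert i T)) U * Z (insert j T) (insert i U) \<le> E (insert j T) (insert i U) * Z (insert j (insert i T)) U"
        unfolding comm by (rule IH) (use jV sub in auto)
      show "E (insert i T) (insert j U) * Z T (insert j (insert i U)) \<le> E T (insert j (insert i U)) * Z (insert i T) (insert j U)"
        unfolding comm by (rule IH) (use jV sub in auto)
    qed
    then show ?thesis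
      by (simp only: sE[of "insert i T" U] sZ[of "insert i T" U] sE[of T "insert i U"] sZ[of T "insert i U"])
  qed
  then show ?case by (simp only: E_def Z_def)
qed


section \<open>Stable polynomials and their homogeneous layers\<close>

definition set_poly :: "'a set \<Rightarrow> ('a set \<Rightarrow> real) \<Rightarrow> ('a \<Rightarrow> complex) \<Rightarrow> complex" where
  "set_poly V w z = (\<Sum>S\<in>Pow V. complex_of_real (w S) * (\<Prod>j\<in>S. z j))"

definition stable_weight :: "'a set \<Rightarrow> ('a set \<Rightarrow> real) \<Rightarrow> bool" where
  "stable_weight V w \<longleftrightarrow> (\<forall>z. (\<forall>j\<in>V. Im (z j) > 0) \<longrightarrow> set_poly V w z \<noteq> 0)"

text \<open>The homogeneous part of degree \<open>k\<close>, extended by zero to all sets so that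
  \<open>stable_weight\<close> applies to it.\<close>

definition layer :: "nat \<Rightarrow> ('a set \<Rightarrow> real) \<Rightarrow> 'a set \<Rightarrow> real" where
  "layer k w S = (if card S = k then w S else 0)"

text \<open>The restriction of \<open>set_poly V w\<close> to the complex line through 0 and
  \<open>z\<close>, as a polynomial in the scalar; its coefficients are the homogeneous parts
  evaluated at \<open>z\<close>.\<close>

definition ray_poly :: "'a set \<Rightarrow> ('a set \<Rightarrow> real) \<Rightarrow> ('a \<Rightarrow> complex) \<Rightarrow> complex poly" where
  "ray_poly V w z = (\<Sum>S\<in>Pow V. monom (complex_of_real (w S) * (\<Prod>j\<in>S. z j)) (card S))"

lemma poly_ray_poly: "finite V \<Longrightarrow> poly (ray_poly V w z) s = set_poly V w (\<lambda>j. s * z j)"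
  unfolding ray_poly_def set_poly_def
  by (simp add: poly_sum poly_monom prod.distrib mult_ac)

lemma coeff_ray_poly: "coeff (ray_poly V w z) k = set_poly V (layer k w) z"
  unfolding ray_poly_def set_poly_def layer_def
  by (auto simp: coeff_sum intro!: sum.cong)

lemma set_poly_layer_card:
  assumes "finite V"
  shows "set_poly V (layer (card V) w) z = complex_of_real (w V) * (\<Prod>j\<in>V. z j)"
proof -
  have "set_poly V (layer (card V) w) z = (\<Sum>S\<in>{V}. complex_of_real (layer (card V) w S) * (\<Prod>j\<in>S. z j))"
    unfolding set_poly_def
    by (rule sum.mono_neutral_right) (use assms card_subset_eq[of V] in \<open>auto simp: layer_def\<close>)
  then show ?thesis by (simp add: layer_def)
qed

lemma degree_ray_poly:
  assumes "finite V" "w V \<noteq> 0" "\<And>j. j \<in> V \<Longrightarrow> z j \<noteq> 0"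
  shows "degree (ray_poly V w z) = card V"
proof (rule antisym)
  have "card S \<le> card V" if "S \<in> Pow V" for S using that assms by (auto intro: card_mono)
  then have "degree (monom c (card S)) \<le> card V" if "S \<in> Pow V" for S and c :: complex
    using that degree_monom_le[of c "card S"] by (meson order_trans)
  then show "degree (ray_poly V w z) \<le> card V"
    unfolding ray_poly_def by (intro degree_sum_le) (use assms in auto)
  show "card V \<le> degree (ray_poly V w z)"
    by (rule le_degree) (use assms in \<open>auto simp: coeff_ray_poly set_poly_layer_card\<close>)
qed

lemma set_poly_cnj: "set_poly V w (\<lambda>j. cnj (z j)) = cnj (set_poly V w z)"
  unfolding set_poly_def by (simp add: cnj_sum cnj_prod)

lemma stable_weightD: "stable_weight V w \<Longrightarrow> (\<And>j. j \<in> V \<Longrightarrow> Im (z j) > 0) \<Longrightarrow> set_poly V w z \<noteq> 0"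
  unfolding stable_weight_def by blast

text \<open>The coefficients are real, so conjugation carries a zero with all coordinates in the
  lower half plane to one in the upper.\<close>

lemma stable_lower:
  assumes "stable_weight V w" "\<And>j. j \<in> V \<Longrightarrow> Im (z j) < 0"
  shows "set_poly V w z \<noteq> 0"
proof
  assume "set_poly V w z = 0"
  then have "set_poly V w (\<lambda>j. cnj (z j)) = 0" by (simp add: set_poly_cnj)
  then show False using assms unfolding stable_weight_def by (auto dest!: spec[of _ "\<lambda>j. cnj (z j)"])
qed

lemma set_poly_pos:
  assumes "finite V" "\<And>S. S \<subseteq> V \<Longrightarrow> w S > 0" "\<And>j. j \<in> V \<Longrightarrow> r j > 0"
  shows "set_poly V w (\<lambda>j. complex_of_real (r j)) \<noteq> 0"
proof -
  have "set_poly V w (\<lambda>j. complex_of_real (r j)) = complex_of_real (\<Sum>S\<in>Pow V. w S * (\<Prod>j\<in>S. r j))"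
    unfolding set_poly_def by simp
  moreover have "(\<Sum>S\<in>Pow V. w S * (\<Prod>j\<in>S. r j)) > 0"
    by (rule sum_pos) (use assms in \<open>auto intro!: mult_pos_pos prod_pos\<close>)
  ultimately show ?thesis by (metis less_irrefl of_real_eq_0_iff)
qed

lemma set_poly_0: "finite V \<Longrightarrow> set_poly V w (\<lambda>j. 0) = complex_of_real (w {})"
proof -
  assume V: "finite V"
  have "set_poly V w (\<lambda>j. 0) = (\<Sum>S\<in>{{}}. complex_of_real (w S) * (\<Prod>j\<in>S. 0))"
    unfolding set_poly_def
  proof (rule sum.mono_neutral_right)
    show "\<forall>S\<in>Pow V - {{}}. complex_of_real (w S) * (\<Prod>j\<in>S. 0) = 0"
      using V finite_subset[of _ V] by (force simp: card_eq_0_iff)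
  qed (use V in auto)
  then show ?thesis by simp
qed

text \<open>For real \<open>r\<close> the coordinates \<open>r * z j\<close> are all in the upper
  half plane, all in the lower one, or all 0; the last case is excluded by
  \<open>w {} > 0\<close>.\<close>

lemma stable_imp_ray_roots_nonreal:
  assumes "stable_weight V w" "finite V" "\<And>S. S \<subseteq> V \<Longrightarrow> w S > 0" "\<And>j. j \<in> V \<Longrightarrow> Im (z j) > 0"
    and root: "poly (ray_poly V w z) r = 0"
  shows "Im r \<noteq> 0"
proof
  assume "Im r = 0"
  then have r: "r = complex_of_real (Re r)" by (simp add: complex_eq_iff)
  have im: "Im (r * z j) = Re r * Im (z j)" for j using \<open>Im r = 0\<close> by simp
  have z: "set_poly V w (\<lambda>j. r * z j) = 0" using root assms(2) by (simp add: poly_ray_poly)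
  consider "Re r > 0" | "Re r = 0" | "Re r < 0" by linarith
  then show False
  proof cases
    case 1
    then show ?thesis using stable_weightD[OF assms(1), of "\<lambda>j. r * z j"] assms(4) z unfolding im by auto
  next
    case 2
    then have "set_poly V w (\<lambda>j. r * z j) = complex_of_real (w {})"
      using r assms(2) by (simp add: set_poly_0)
    then show ?thesis using z assms(3)[of "{}"] by simp
  next
    case 3
    then show ?thesis using stable_lower[OF assms(1), of "\<lambda>j. r * z j"] assms(4) z unfolding im
      by (auto intro: mult_neg_pos)
  qed
qed

text \<open>The point \<open>z\<close> is deformed from its purely imaginary part. The degree stays
  \<open>card V\<close> because \<open>w V > 0\<close>, and no root becomes real on the way, so it
  suffices to inspect the starting point.\<close>

lemma stable_imp_ray_roots_upper:
  assumes st: "stable_weight V w" and V: "finite V" and w: "\<And>S. S \<subseteq> V \<Longrightarrow> w S > 0"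
    and z: "\<And>j. j \<in> V \<Longrightarrow> Im (z j) > 0"
    and root: "poly (ray_poly V w z) r = 0"
  shows "Im r > 0"
proof -
  define zt where "zt t = (\<lambda>j. Complex (t * Re (z j)) (Im (z j)))" for t :: real
  have im: "Im (zt t j) > 0" if "j \<in> V" for t j using z that by (simp add: zt_def)
  have "zt 1 = z" by (simp add: zt_def)
  have ztc: "zt t j = complex_of_real t * complex_of_real (Re (z j)) + \<i> * complex_of_real (Im (z j))" for t j
    by (simp add: zt_def complex_eq_iff)
  have "Im s > 0" if "poly (ray_poly V w (zt 1)) s = 0" for s
  proof (rule no_roots_lower_half_plane_persists[where p = "\<lambda>t. ray_poly V w (zt t)" and t = 1 and n = "card V"])
    show "degree (ray_poly V w (zt t)) = card V" for t
    proof (rule degree_ray_poly[OF V])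
      show "w V \<noteq> 0" using w[of V] by simp
      show "zt t j \<noteq> 0" if "j \<in> V" for j using im[OF that, of t] by force
    qed
    show "continuous_on {0..1} (\<lambda>t. coeff (ray_poly V w (zt t)) k)" for k
      unfolding coeff_ray_poly set_poly_def ztc by (intro continuous_intros)
    show "Im r \<noteq> 0" if "poly (ray_poly V w (zt t)) r = 0" for t r
      by (rule stable_imp_ray_roots_nonreal[OF st V w im that])
    \<comment> \<open>At the start, multiplication by \<open>r\<close> gives all coordinates
      imaginary parts of the sign of \<open>Re r\<close>. If \<open>Re r = 0\<close> and
      \<open>Im r < 0\<close>, they are positive reals, where a polynomial with positive
      coefficients cannot vanish.\<close>
    show "Im r \<ge> 0" if r: "poly (ray_poly V w (zt 0)) r = 0" for r
    proof (rule ccontr)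
      assume neg: "\<not> Im r \<ge> 0"
      have z0: "set_poly V w (\<lambda>j. r * zt 0 j) = 0" using r V by (simp add: poly_ray_poly)
      have imr: "Im (r * zt 0 j) = Re r * Im (z j)" for j by (simp add: zt_def)
      consider "Re r > 0" | "Re r = 0" | "Re r < 0" by linarith
      then show False
      proof cases
        case 1
        then show ?thesis using stable_weightD[OF st, of "\<lambda>j. r * zt 0 j"] z z0 unfolding imr by auto
      next
        case 2
        then have "(\<lambda>j. r * zt 0 j) = (\<lambda>j. complex_of_real (- Im r * Im (z j)))"
          by (auto simp: zt_def complex_eq_iff)
        then show ?thesis using set_poly_pos[OF V w, where r = "\<lambda>j. - Im r * Im (z j)"] z0 neg z by (simp add: mult_neg_pos)
      next
        case 3
        then show ?thesis using stable_lower[OF st, of "\<lambda>j. r * zt 0 j"] z z0 unfolding imr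
          by (auto intro: mult_neg_pos)
      qed
    qed
  qed (use that in auto)
  then show ?thesis using root \<open>zt 1 = z\<close> by simp
qed

text \<open>The layer at \<open>z\<close> is coefficient \<open>k\<close> of the ray polynomial, all
  of whose roots lie in the upper half plane.\<close>

lemma stable_layer:
  assumes "stable_weight V w" "finite V" "\<And>S. S \<subseteq> V \<Longrightarrow> w S > 0" "k \<le> card V"
  shows "stable_weight V (layer k w)"
  unfolding stable_weight_def
proof (intro allI impI)
  fix z :: "'a \<Rightarrow> complex" assume z: "\<forall>j\<in>V. Im (z j) > 0"
  have "degree (ray_poly V w z) = card V"
  proof (rule degree_ray_poly[OF assms(2)])
    show "w V \<noteq> 0" using assms(3)[of V] by simp
    show "z j \<noteq> 0" if "j \<in> V" for j using z that by force
  qed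
  then have "coeff (ray_poly V w z) k \<noteq> 0"
    using stable_imp_ray_roots_upper[OF assms(1-3)] z assms(4)
    by (intro coeff_nonzero_if_roots_upper_half_plane) auto
  then show "set_poly V (layer k w) z \<noteq> 0" by (simp add: coeff_ray_poly)
qed

section \<open>Operations that preserve stability\<close>

lemma sum_Pow_insert:
  fixes h :: "'a set \<Rightarrow> 'b :: comm_monoid_add"
  assumes "finite V" "v \<notin> V"
  shows "sum h (Pow (insert v V)) = sum h (Pow V) + (\<Sum>S\<in>Pow V. h (insert v S))"
proof -
  have inj: "inj_on (insert v) (Pow V)" using assms by (auto simp: inj_on_def)
  have "sum h (Pow V \<union> insert v ` Pow V) = sum h (Pow V) + sum h (insert v ` Pow V)"
    by (rule sum.union_disjoint) (use assms in auto)
  then show ?thesis by (simp add: Pow_insert sum.reindex[OF inj])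
qed

text \<open>The generating polynomial is multiplied by \<open>1 + z v\<close>, which does not vanish
  in the upper half plane. Up to normalization this adjoins an independent fair coordinate
  \<open>v\<close>.\<close>

lemma stable_insert:
  assumes "stable_weight V w" "finite V" "v \<notin> V"
  shows "stable_weight (insert v V) (\<lambda>S. w (S - {v}))"
  unfolding stable_weight_def
proof (intro allI impI)
  fix z :: "'a \<Rightarrow> complex" assume z: "\<forall>j\<in>insert v V. Im (z j) > 0"
  have "set_poly (insert v V) (\<lambda>S. w (S - {v})) z = (1 + z v) * set_poly V w z"
  proof -
    have "(\<Sum>S\<in>Pow V. complex_of_real (w (insert v S - {v})) * (\<Prod>j\<in>insert v S. z j)) = z v * set_poly V w z"
      unfolding set_poly_def sum_distrib_left
    proof (rule sum.cong)
      fix S assume S: "S \<in> Pow V"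
      then have "finite S" "v \<notin> S" using assms finite_subset by auto
      then show "complex_of_real (w (insert v S - {v})) * (\<Prod>j\<in>insert v S. z j) = z v * (complex_of_real (w S) * (\<Prod>j\<in>S. z j))"
        by simp
    qed simp
    moreover have "(\<Sum>S\<in>Pow V. complex_of_real (w (S - {v})) * (\<Prod>j\<in>S. z j)) = set_poly V w z"
      unfolding set_poly_def
    proof (rule sum.cong)
      fix S assume "S \<in> Pow V"
      then have "S - {v} = S" using assms by auto
      then show "complex_of_real (w (S - {v})) * (\<Prod>j\<in>S. z j) = complex_of_real (w S) * (\<Prod>j\<in>S. z j)" by simp
    qed simp
    ultimately show ?thesis using assms by (simp add: set_poly_def sum_Pow_insert algebra_simps)
  qed
  moreover have "1 + z v \<noteq> 0" using z by (auto simp: complex_eq_iff)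
  moreover have "set_poly V w z \<noteq> 0" using z assms unfolding stable_weight_def by auto
  ultimately show "set_poly (insert v V) (\<lambda>S. w (S - {v})) z \<noteq> 0" by simp
qed

text \<open>The kernel flips every coordinate independently with odds \<open>\<epsilon>\<close>; on generating polynomials this
  is the Moebius substitution \<open>z \<mapsto> (z + \<epsilon>) / (1 + \<epsilon> z)\<close>.\<close>

definition flip_kernel :: "'a set \<Rightarrow> real \<Rightarrow> 'a set \<Rightarrow> 'a set \<Rightarrow> real" where
  "flip_kernel V \<epsilon> T S = (\<Prod>j\<in>V. if (j \<in> S) = (j \<in> T) then 1 else \<epsilon>)"

definition noise :: "'a set \<Rightarrow> real \<Rightarrow> ('a set \<Rightarrow> real) \<Rightarrow> 'a set \<Rightarrow> real" where
  "noise V \<epsilon> w S = (\<Sum>T\<in>Pow V. w T * flip_kernel V \<epsilon> T S)"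

lemma noise_pos:
  assumes "finite V" "\<epsilon> > 0" "\<And>S. S \<subseteq> V \<Longrightarrow> w S \<ge> 0" "sum w (Pow V) > 0"
  shows "noise V \<epsilon> w S > 0"
proof -
  have K: "flip_kernel V \<epsilon> T S > 0" for T
    unfolding flip_kernel_def by (rule prod_pos) (use assms in auto)
  have "\<exists>T\<in>Pow V. w T > 0"
  proof (rule ccontr)
    assume "\<not> ?thesis"
    then have "sum w (Pow V) \<le> 0" by (intro sum_nonpos) (auto simp: not_less)
    then show False using assms by simp
  qed
  then obtain T where T: "T \<in> Pow V" "w T > 0" by auto
  have "0 < w T * flip_kernel V \<epsilon> T S" using T K by simp
  also have "\<dots> \<le> noise V \<epsilon> w S" unfolding noise_def
    by (rule member_le_sum) (use T assms K[THEN less_imp_le] in auto)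
  finally show ?thesis .
qed

lemma noise_0:
  assumes "finite V" "S \<subseteq> V"
  shows "noise V 0 w S = w S"
proof -
  have "flip_kernel V 0 T S = (if T = S then 1 else 0)" if T: "T \<subseteq> V" for T
  proof (cases "T = S")
    case False
    then obtain j where "j \<in> V" "(j \<in> S) \<noteq> (j \<in> T)" using T assms by blast
    then show ?thesis unfolding flip_kernel_def using assms False by (auto intro!: prod_zero bexI[of _ j])
  qed (simp add: flip_kernel_def)
  then have "noise V 0 w S = (\<Sum>T\<in>Pow V. if T = S then w T else 0)"
    unfolding noise_def by (intro sum.cong) auto
  then show ?thesis using assms by simp
qed

lemma continuous_noise [continuous_intros]: "continuous_on A (\<lambda>\<epsilon>. noise V \<epsilon> w S)"
proof -
  have "continuous_on A (\<lambda>\<epsilon>. flip_kernel V \<epsilon> T S)" for T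
    unfolding flip_kernel_def
  proof (intro continuous_on_prod)
    show "continuous_on A (\<lambda>\<epsilon>. if (j \<in> S) = (j \<in> T) then 1 else \<epsilon>)" for j
      by (cases "(j \<in> S) = (j \<in> T)") (simp_all add: continuous_on_id)
  qed
  then show ?thesis unfolding noise_def by (intro continuous_intros)
qed

text \<open>The new polynomial is the old one at \<open>u\<close> times the product of the
  \<open>1 + of_real \<epsilon> * z j\<close>. The Moebius map has determinant
  \<open>1 - \<epsilon> * \<epsilon> > 0\<close> and so preserves the upper half plane.\<close>

lemma stable_noise:
  assumes V: "finite V" and st: "stable_weight V w" and e: "0 < \<epsilon>" "\<epsilon> < 1"
  shows "stable_weight V (noise V \<epsilon> w)"
  unfolding stable_weight_def
proof (intro allI impI)
  fix z :: "'a \<Rightarrow> complex" assume z: "\<forall>j\<in>V. Im (z j) > 0"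
  define u where "u j = (z j + of_real \<epsilon>) / (1 + of_real \<epsilon> * z j)" for j
  have ne: "1 + of_real \<epsilon> * z j \<noteq> 0" if "j \<in> V" for j
    using z that e by (auto simp: complex_eq_iff)
  have imu: "Im (u j) > 0" if "j \<in> V" for j
  proof -
    have pos: "(1 + \<epsilon> * Re (z j))\<^sup>2 + (\<epsilon> * Im (z j))\<^sup>2 > 0"
      using z that e by (intro add_nonneg_pos) auto
    have "\<epsilon> * \<epsilon> < 1" using mult_strict_mono[of \<epsilon> 1 \<epsilon> 1] e by simp
    have "Im (u j) = (Im (z j) * (1 - \<epsilon> * \<epsilon>)) / ((1 + \<epsilon> * Re (z j))\<^sup>2 + (\<epsilon> * Im (z j))\<^sup>2)"
      unfolding u_def Im_divide by (simp add: algebra_simps)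
    then show ?thesis using pos z that \<open>\<epsilon> * \<epsilon> < 1\<close> by simp
  qed
  have "set_poly V (noise V \<epsilon> w) z = (\<Sum>S\<in>Pow V. \<Sum>T\<in>Pow V. complex_of_real (w T) * (complex_of_real (flip_kernel V \<epsilon> T S) * (\<Prod>j\<in>S. z j)))"
    unfolding set_poly_def noise_def by (simp add: sum_distrib_left mult_ac)
  also have "\<dots> = (\<Sum>T\<in>Pow V. complex_of_real (w T) * (\<Sum>S\<in>Pow V. complex_of_real (flip_kernel V \<epsilon> T S) * (\<Prod>j\<in>S. z j)))"
    unfolding sum_distrib_left by (rule sum.swap)
  also have "\<dots> = (\<Sum>T\<in>Pow V. complex_of_real (w T) * ((\<Prod>j\<in>V. 1 + of_real \<epsilon> * z j) * (\<Prod>j\<in>T. u j)))"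
  proof (intro sum.cong refl arg_cong2[where f = "(*)"])
    fix T assume T: "T \<in> Pow V"
    \<comment> \<open>\<open>\<alpha> j\<close> is the factor of \<open>j\<close> when it is put
      into \<open>S\<close>, \<open>\<beta> j\<close> when it is left out; expanding the product of
      the sums runs over all \<open>S\<close>.\<close>
    define \<alpha> \<beta> where "\<alpha> j = (if j \<in> T then z j else of_real \<epsilon> * z j)"
      and "\<beta> j = (if j \<in> T then of_real \<epsilon> else 1 :: complex)" for j
    have "(\<Prod>j\<in>V. 1 + of_real \<epsilon> * z j) * (\<Prod>j\<in>T. u j) = (\<Prod>j\<in>V. \<alpha> j + \<beta> j)"
    proof -
      have "(\<Prod>j\<in>T. u j) = (\<Prod>j\<in>V. if j \<in> T then u j else 1)"
        using T V by (simp add: prod.inter_restrict[symmetric] Int_absorb1)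
      then have "(\<Prod>j\<in>V. 1 + of_real \<epsilon> * z j) * (\<Prod>j\<in>T. u j) = (\<Prod>j\<in>V. (1 + of_real \<epsilon> * z j) * (if j \<in> T then u j else 1))"
        by (simp add: prod.distrib)
      also have "\<dots> = (\<Prod>j\<in>V. \<alpha> j + \<beta> j)"
        by (rule prod.cong) (use ne in \<open>auto simp: u_def \<alpha>_def \<beta>_def\<close>)
      finally show ?thesis .
    qed
    also have "\<dots> = (\<Sum>S\<in>Pow V. (\<Prod>j\<in>S. \<alpha> j) * (\<Prod>j\<in>V - S. \<beta> j))"
      by (rule prod_add[OF V])
    also have "\<dots> = (\<Sum>S\<in>Pow V. complex_of_real (flip_kernel V \<epsilon> T S) * (\<Prod>j\<in>S. z j))"
    proof (rule sum.cong)
      fix S assume S: "S \<in> Pow V"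
      have "(\<Prod>j\<in>S. \<alpha> j) = (\<Prod>j\<in>S. complex_of_real (if (j \<in> S) = (j \<in> T) then 1 else \<epsilon>)) * (\<Prod>j\<in>S. z j)"
        unfolding prod.distrib[symmetric] by (rule prod.cong) (auto simp: \<alpha>_def)
      moreover have "(\<Prod>j\<in>V - S. \<beta> j) = (\<Prod>j\<in>V - S. complex_of_real (if (j \<in> S) = (j \<in> T) then 1 else \<epsilon>))"
        by (rule prod.cong) (auto simp: \<beta>_def)
      moreover have "complex_of_real (flip_kernel V \<epsilon> T S) =
          (\<Prod>j\<in>V - S. complex_of_real (if (j \<in> S) = (j \<in> T) then 1 else \<epsilon>)) *
          (\<Prod>j\<in>S. complex_of_real (if (j \<in> S) = (j \<in> T) then 1 else \<epsilon>))"
        unfolding flip_kernel_def of_real_prod using S V by (intro prod.subset_diff) auto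
      ultimately show "(\<Prod>j\<in>S. \<alpha> j) * (\<Prod>j\<in>V - S. \<beta> j) = complex_of_real (flip_kernel V \<epsilon> T S) * (\<Prod>j\<in>S. z j)"
        by (simp only: mult_ac)
    qed simp
    finally show "(\<Sum>S\<in>Pow V. complex_of_real (flip_kernel V \<epsilon> T S) * (\<Prod>j\<in>S. z j)) = (\<Prod>j\<in>V. 1 + of_real \<epsilon> * z j) * (\<Prod>j\<in>T. u j)"
      by simp
  qed
  also have "\<dots> = (\<Prod>j\<in>V. 1 + of_real \<epsilon> * z j) * set_poly V w u"
    unfolding set_poly_def sum_distrib_left by (simp only: mult_ac)
  finally have "set_poly V (noise V \<epsilon> w) z = (\<Prod>j\<in>V. 1 + of_real \<epsilon> * z j) * set_poly V w u" .
  moreover have "(\<Prod>j\<in>V. 1 + of_real \<epsilon> * z j) \<noteq> 0" using V ne by (simp add: prod_zero_iff)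
  moreover have "set_poly V w u \<noteq> 0" using st imu unfolding stable_weight_def by auto
  ultimately show "set_poly V (noise V \<epsilon> w) z \<noteq> 0" by simp
qed


section \<open>From stable layers to negative dependence\<close>

text \<open>Fix \<open>x = \<i>\<close>. If the inequality failed, the root \<open>y\<close> of \<open>A + B x + C y + D x y\<close> at the boundary
  point \<open>\<eta> = 0\<close> would lie in the open upper half plane, hence also for small \<open>\<eta> > 0\<close>. Letting
  \<open>\<eta> \<rightarrow> 0\<close> forces the elements of \<open>T\<close> into the set and those of \<open>U\<close> out of it.\<close>

lemma stable_layer_imp_neg_dep:
  assumes V: "finite V" and w: "\<And>S. S \<subseteq> V \<Longrightarrow> card S = k \<Longrightarrow> w S > 0" and st: "stable_weight V (layer k w)"
  shows "neg_dep V k w"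
  unfolding neg_dep_def
proof (intro conjI allI impI)
  fix S assume "S \<subseteq> V" "card S = k" then show "w S > 0" by (rule w)
next
  fix T U i j
  assume TU: "T \<subseteq> V" "U \<subseteq> V" "T \<inter> U = {}" "i \<in> V - T - U" "j \<in> V - T - U" "i \<noteq> j"
  define a b c d where "a = sum w (slice V k T (insert i (insert j U)))"
    and "b = sum w (slice V k (insert i T) (insert j U))"
    and "c = sum w (slice V k (insert j T) (insert i U))"
    and "d = sum w (slice V k (insert i (insert j T)) U)"
  have nonneg: "a \<ge> 0" "b \<ge> 0" "c \<ge> 0" "d \<ge> 0"
    unfolding a_def b_def c_def d_def by (intro sum_nonneg less_imp_le[OF w]; simp add: slice_def)+
  have "d * a \<le> b * c"
  proof (rule ccontr)
    assume neg: "\<not> d * a \<le> b * c"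
    have "0 \<le> b * c" using nonneg by simp
    then have "d \<noteq> 0" using neg by auto
    \<comment> \<open>The term of \<open>S\<close> at the test point \<open>z\<close> below, without
      the factors of \<open>i\<close> and \<open>j\<close>, times
      \<open>- \<i> * of_real \<eta>\<close> for each element of \<open>T\<close>. This cancels the
      coordinate \<open>\<i> / of_real \<eta>\<close> of an element of \<open>T\<close> in
      \<open>S\<close>; elements of \<open>T\<close> outside \<open>S\<close> and of
      \<open>U\<close> inside \<open>S\<close> leave factors that vanish at
      \<open>\<eta> = 0\<close>.\<close>
    define m where "m \<eta> S = complex_of_real (w S) * (\<Prod>l\<in>S - {i,j}. if l \<in> T then 1 else if l \<in> U then \<i> * of_real \<eta> else 1 + \<i> * of_real \<eta>)
       * (\<Prod>l\<in>T - S. - \<i> * of_real \<eta>)" for \<eta> :: real and S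
    define X where "X = {S. S \<subseteq> V \<and> card S = k}"
    have X: "finite X" unfolding X_def using V by simp
    define A B C D where "A \<eta> = sum (m \<eta>) {S\<in>X. i \<notin> S \<and> j \<notin> S}" and "B \<eta> = sum (m \<eta>) {S\<in>X. i \<in> S \<and> j \<notin> S}"
      and "C \<eta> = sum (m \<eta>) {S\<in>X. i \<notin> S \<and> j \<in> S}" and "D \<eta> = sum (m \<eta>) {S\<in>X. i \<in> S \<and> j \<in> S}" for \<eta>
    have m0: "sum (m 0) {S\<in>X. Q S} = complex_of_real (sum w {S\<in>X. Q S \<and> T \<subseteq> S \<and> S \<inter> U = {}})" for Q
    proof -
      have "sum (m 0) {S\<in>X. Q S} = sum (m 0) {S\<in>X. Q S \<and> T \<subseteq> S \<and> S \<inter> U = {}}"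
      proof (rule sum.mono_neutral_right)
        show "\<forall>S\<in>{S\<in>X. Q S} - {S\<in>X. Q S \<and> T \<subseteq> S \<and> S \<inter> U = {}}. m 0 S = 0"
        proof
          fix S assume S: "S \<in> {S\<in>X. Q S} - {S\<in>X. Q S \<and> T \<subseteq> S \<and> S \<inter> U = {}}"
          then have fin: "finite S" "finite T" using TU by (auto simp: X_def intro: finite_subset[OF _ V])
          from S consider "T - S \<noteq> {}" | l where "l \<in> S" "l \<in> U" by auto
          then show "m 0 S = 0"
          proof cases
            case 1
            then have "card (T - S) > 0" using fin by (simp add: card_gt_0_iff)
            then show ?thesis by (simp add: m_def)
          next
            case 2
            then have "(\<Prod>l\<in>S - {i,j}. if l \<in> T then 1 else if l \<in> U then \<i> * of_real 0 else 1 + \<i> * of_real 0) = (0::complex)"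
              using fin TU by (intro prod_zero bexI[of _ l]) auto
            then show ?thesis by (simp add: m_def)
          qed
        qed
      qed (use X in auto)
      also have "\<dots> = (\<Sum>S\<in>{S\<in>X. Q S \<and> T \<subseteq> S \<and> S \<inter> U = {}}. complex_of_real (w S))"
      proof (rule sum.cong)
        fix S assume S: "S \<in> {S\<in>X. Q S \<and> T \<subseteq> S \<and> S \<inter> U = {}}"
        then have "(\<Prod>l\<in>S - {i,j}. if l \<in> T then 1 else if l \<in> U then \<i> * of_real 0 else 1 + \<i> * of_real 0) = (1::complex)"
          by (intro prod.neutral) auto
        moreover have "T - S = {}" using S by auto
        ultimately show "m 0 S = complex_of_real (w S)" by (simp only: m_def prod.empty mult_1_right)
      qed simp
      finally show ?thesis by simp
    qed
    have abcd: "A 0 = of_real a" "B 0 = of_real b" "C 0 = of_real c" "D 0 = of_real d"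
      unfolding A_def B_def C_def D_def m0 a_def b_def c_def d_def unfolding slice_def X_def
      by (rule arg_cong[where f = "\<lambda>Y. complex_of_real (sum w Y)"]; blast)+
    have cont: "isCont (\<lambda>\<eta>. sum (m \<eta>) Y) 0" for Y
    proof -
      have c0: "continuous_on UNIV (\<lambda>\<eta>. if l \<in> T then 1 else if l \<in> U then \<i> * of_real \<eta> else 1 + \<i> * complex_of_real \<eta>)" for l
        by (cases "l \<in> T"; cases "l \<in> U") (auto intro!: continuous_intros)
      have "continuous_on UNIV (\<lambda>\<eta>. sum (m \<eta>) Y)"
        unfolding m_def by (intro continuous_intros c0)
      then show ?thesis by (simp add: continuous_on_eq_continuous_at)
    qed
    \<comment> \<open>The value of coordinate \<open>j\<close> that makes the polynomial vanish when
      coordinate \<open>i\<close> is the imaginary unit. At \<open>\<eta> = 0\<close> its imaginary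
      part has the sign of \<open>d * a - b * c\<close>, positive by assumption.\<close>
    define y where "y \<eta> = - (A \<eta> + B \<eta> * \<i>) / (C \<eta> + D \<eta> * \<i>)" for \<eta>
    have cd: "C 0 + D 0 * \<i> \<noteq> 0" using abcd \<open>d \<noteq> 0\<close> by (auto simp: complex_eq_iff)
    have cont': "isCont A 0" "isCont B 0" "isCont C 0" "isCont D 0"
      unfolding A_def B_def C_def D_def by (rule cont)+
    have "isCont y 0" unfolding y_def by (intro continuous_intros cont' cd)
    then have ycont: "isCont (\<lambda>\<eta>. Im (y \<eta>)) 0" unfolding isCont_def by (rule tendsto_Im)
    have "c\<^sup>2 + d\<^sup>2 > 0" using \<open>d \<noteq> 0\<close> by (simp add: sum_power2_gt_zero_iff)
    moreover have "Im (y 0) = (d * a - b * c) / (c\<^sup>2 + d\<^sup>2)"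
      unfolding y_def abcd by (simp add: Im_divide field_simps power2_eq_square)
    ultimately have "Im (y 0) > 0" using neg by simp
    then have "\<forall>\<^sub>F \<eta> in at 0. Im (y \<eta>) > 0"
      using ycont unfolding isCont_def by (intro order_tendstoD(1))
    moreover have "\<forall>\<^sub>F \<eta> in at 0. C \<eta> + D \<eta> * \<i> \<noteq> 0"
    proof -
      have "isCont (\<lambda>\<eta>. C \<eta> + D \<eta> * \<i>) 0" by (intro continuous_intros cont')
      then show ?thesis using cd unfolding isCont_def by (rule tendsto_imp_eventually_ne)
    qed
    ultimately have "\<forall>\<^sub>F \<eta> in at 0. Im (y \<eta>) > 0 \<and> C \<eta> + D \<eta> * \<i> \<noteq> 0"
      by (rule eventually_conj)
    then have "\<forall>\<^sub>F \<eta> in at_right 0. Im (y \<eta>) > 0 \<and> C \<eta> + D \<eta> * \<i> \<noteq> 0"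
      unfolding eventually_at_split by blast
    moreover have "\<forall>\<^sub>F \<eta> in at_right 0. \<eta> > (0::real)" by (rule eventually_at_right_less)
    ultimately have "\<forall>\<^sub>F \<eta> in at_right 0. Im (y \<eta>) > 0 \<and> C \<eta> + D \<eta> * \<i> \<noteq> 0 \<and> \<eta> > 0"
      by eventually_elim auto
    then obtain \<eta> where \<eta>: "Im (y \<eta>) > 0" "C \<eta> + D \<eta> * \<i> \<noteq> 0" "\<eta> > 0"
      using eventually_happens trivial_limit_at_right_real by blast
    \<comment> \<open>For \<open>\<eta> > 0\<close> all coordinates lie in the open upper half
      plane, yet the choice of \<open>y\<close> makes this point a zero of the stable layer.\<close>
    define z where "z l = (if l = i then \<i> else if l = j then y \<eta> else if l \<in> T then \<i> / of_real \<eta>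
       else if l \<in> U then \<i> * of_real \<eta> else 1 + \<i> * of_real \<eta>)" for l
    have zpos: "\<forall>l\<in>V. Im (z l) > 0" using \<eta> by (auto simp: z_def)
    define M where "M = (\<Prod>l\<in>T. - \<i> * complex_of_real \<eta>)"
    have "M * set_poly V (layer k w) z = (\<Sum>S\<in>X. m \<eta> S * (if i \<in> S then \<i> else 1) * (if j \<in> S then y \<eta> else 1))"
    proof -
      have "set_poly V (layer k w) z = (\<Sum>S\<in>X. complex_of_real (w S) * (\<Prod>l\<in>S. z l))"
      proof -
        have "set_poly V (layer k w) z = (\<Sum>S\<in>X. complex_of_real (layer k w S) * (\<Prod>l\<in>S. z l))"
          unfolding set_poly_def by (rule sum.mono_neutral_right) (use V in \<open>auto simp: X_def layer_def\<close>)
        then show ?thesis by (simp add: layer_def X_def)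
      qed
      moreover have "M * (complex_of_real (w S) * (\<Prod>l\<in>S. z l)) = m \<eta> S * (if i \<in> S then \<i> else 1) * (if j \<in> S then y \<eta> else 1)"
        if S: "S \<in> X" for S
      proof -
        have fin: "finite S" "finite T" using S TU by (auto simp: X_def intro: finite_subset[OF _ V])
        have "(\<Prod>l\<in>S. z l) = (\<Prod>l\<in>S - {i,j}. z l) * (\<Prod>l\<in>S \<inter> {i,j}. z l)"
          by (subst prod.Int_Diff[OF fin(1), of _ "{i,j}"]) (rule mult.commute)
        also have "(\<Prod>l\<in>S \<inter> {i,j}. z l) = (if i \<in> S then \<i> else 1) * (if j \<in> S then y \<eta> else 1)"
          using TU by (auto simp: z_def Int_insert_right)
        finally have 1: "(\<Prod>l\<in>S. z l) = (\<Prod>l\<in>S - {i,j}. z l) * ((if i \<in> S then \<i> else 1) * (if j \<in> S then y \<eta> else 1))" .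
        have 2: "M = (\<Prod>l\<in>T - S. - \<i> * complex_of_real \<eta>) * (\<Prod>l\<in>T \<inter> S. - \<i> * complex_of_real \<eta>)"
          unfolding M_def by (subst prod.Int_Diff[OF fin(2), of _ S]) (rule mult.commute)
        have 3: "(\<Prod>l\<in>T \<inter> S. - \<i> * complex_of_real \<eta>) = (\<Prod>l\<in>S - {i,j}. if l \<in> T then - \<i> * complex_of_real \<eta> else 1)"
        proof -
          have "T \<inter> S = (S - {i,j}) \<inter> T" using TU by auto
          then show ?thesis using prod.inter_restrict[OF finite_Diff[OF fin(1)]] by (simp only:)
        qed
        have 4: "(\<Prod>l\<in>T \<inter> S. - \<i> * complex_of_real \<eta>) * (\<Prod>l\<in>S - {i,j}. z l)
          = (\<Prod>l\<in>S - {i,j}. if l \<in> T then 1 else if l \<in> U then \<i> * of_real \<eta> else 1 + \<i> * of_real \<eta>)"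
          unfolding 3 prod.distrib[symmetric]
          by (rule prod.cong) (use \<eta> in \<open>auto simp: z_def\<close>)
        show ?thesis unfolding 1 2 m_def 4[symmetric] by (simp only: mult_ac)
      qed
      ultimately show ?thesis by (simp add: sum_distrib_left)
    qed
    also have "\<dots> = A \<eta> + B \<eta> * \<i> + C \<eta> * y \<eta> + D \<eta> * \<i> * y \<eta>"
    proof -
      have split: "sum h X = sum h {S\<in>X. i \<notin> S \<and> j \<notin> S} + sum h {S\<in>X. i \<in> S \<and> j \<notin> S}
          + sum h {S\<in>X. i \<notin> S \<and> j \<in> S} + sum h {S\<in>X. i \<in> S \<and> j \<in> S}" for h :: "'a set \<Rightarrow> complex"
      proof -
        have "sum h X = sum h {S\<in>X. i \<notin> S} + sum h {S\<in>X. i \<in> S}"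
          using X by (subst sum.union_disjoint[symmetric]) (auto intro!: sum.cong)
        moreover have "sum h {S\<in>X. i \<notin> S} = sum h {S\<in>X. i \<notin> S \<and> j \<notin> S} + sum h {S\<in>X. i \<notin> S \<and> j \<in> S}"
          using X by (subst sum.union_disjoint[symmetric]) (auto intro!: sum.cong)
        moreover have "sum h {S\<in>X. i \<in> S} = sum h {S\<in>X. i \<in> S \<and> j \<notin> S} + sum h {S\<in>X. i \<in> S \<and> j \<in> S}"
          using X by (subst sum.union_disjoint[symmetric]) (auto intro!: sum.cong)
        ultimately show ?thesis by (simp add: algebra_simps)
      qed
      show ?thesis
        unfolding split A_def B_def C_def D_def sum_distrib_right
        by (intro arg_cong2[where f = "(+)"] sum.cong) auto
    qed
    also have "\<dots> = (A \<eta> + B \<eta> * \<i>) + y \<eta> * (C \<eta> + D \<eta> * \<i>)" by (simp add: algebra_simps)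
    also have "\<dots> = 0" using \<eta>(2) by (simp add: y_def)
    finally have "M * set_poly V (layer k w) z = 0" .
    moreover have "M \<noteq> 0" unfolding M_def using \<eta> finite_subset[OF TU(1) V] by (simp add: prod_zero_iff)
    ultimately show False using st zpos unfolding stable_weight_def by auto
  qed
  then show "sum w (slice V k (insert i (insert j T)) U) * sum w (slice V k T (insert i (insert j U)))
       \<le> sum w (slice V k (insert i T) (insert j U)) * sum w (slice V k (insert j T) (insert i U))"
    by (simp only: a_def b_def c_def d_def)
qed


section \<open>Lipschitz functions on homogeneous measures\<close>

definition lip :: "'a set \<Rightarrow> ('a set \<Rightarrow> real) \<Rightarrow> bool" where
  "lip V f \<longleftrightarrow> (\<forall>S\<subseteq>V. \<forall>j\<in>V - S. \<bar>f (insert j S) - f S\<bar> \<le> 1)"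

text \<open>The conditional mean of \<open>f\<close> given size \<open>k\<close> and
  \<open>T\<close> present; along a growing \<open>T\<close> these are the values of the
  martingale.\<close>

definition avg :: "'a set \<Rightarrow> nat \<Rightarrow> ('a set \<Rightarrow> real) \<Rightarrow> ('a set \<Rightarrow> real) \<Rightarrow> 'a set \<Rightarrow> real" where
  "avg V k w f T = (\<Sum>S\<in>slice V k T {}. w S * f S) / sum w (slice V k T {})"

lemma neg_dep_pos: "neg_dep V k w \<Longrightarrow> S \<subseteq> V \<Longrightarrow> card S = k \<Longrightarrow> w S > 0"
  unfolding neg_dep_def by blast

lemma lipD: "lip V f \<Longrightarrow> S \<subseteq> V \<Longrightarrow> j \<in> V \<Longrightarrow> j \<notin> S \<Longrightarrow> \<bar>f (insert j S) - f S\<bar> \<le> 1"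
  unfolding lip_def by blast

lemma lip_uminus: "lip V f \<Longrightarrow> lip V (\<lambda>S. - f S)"
  unfolding lip_def by (simp add: abs_minus_commute)

text \<open>Each added element lowers \<open>f\<close> by at most 1 and raises the cardinality by
  exactly 1. This supplies the monotone functions to which \<open>Feder_Mihail\<close> is
  applied.\<close>

lemma lip_plus_card_mono:
  assumes "lip V f" "finite V" "A \<subseteq> B" "B \<subseteq> V"
  shows "f A + real (card A) \<le> f B + real (card B)"
proof -
  have fB: "finite B" by (rule finite_subset[OF assms(4,2)])
  have "finite (B - A)" using fB by simp
  have "f A + real (card A) \<le> f (A \<union> C) + real (card (A \<union> C))" if "C \<subseteq> B - A" for C
    using finite_subset[OF that \<open>finite (B - A)\<close>] that
  proof (induction C rule: finite_induct)
    case (insert j C)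
    have "finite (A \<union> C)" using insert.hyps(1) finite_subset[OF assms(3) fB] by simp
    moreover have "j \<notin> A \<union> C" using insert by auto
    moreover have "\<bar>f (insert j (A \<union> C)) - f (A \<union> C)\<bar> \<le> 1"
      using insert.hyps insert.prems assms(3,4) by (intro lipD[OF assms(1)]) auto
    ultimately show ?case using insert.IH insert.prems by (simp add: abs_le_iff)
  qed simp
  from this[of "B - A"] show ?thesis using assms(3) by (simp add: Un_absorb1)
qed

lemma exp_le_quadratic:
  fixes x :: real
  assumes "\<bar>x\<bar> \<le> 1"
  shows "exp x \<le> 1 + x + x\<^sup>2"
proof (cases "0 \<le> x")
  case True
  then show ?thesis using exp_bound assms by simp
next
  case False
  define y where "y = - x"
  have y: "0 \<le> y" using False y_def by simp
  have e: "1 + y + y\<^sup>2 / 2 \<le> exp y" using exp_lower_Taylor_quadratic[OF y] .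
  \<comment> \<open>The claim amounts to \<open>1 \<le> (1 - y + y\<^sup>2) * exp y\<close>, which
    already holds with the quadratic Taylor polynomial in place of \<open>exp y\<close>.\<close>
  have "1 \<le> (1 - y + y\<^sup>2) * (1 + y + y\<^sup>2 / 2)"
  proof -
    have "(1 - y + y\<^sup>2) * (1 + y + y\<^sup>2 / 2) = 1 + (y\<^sup>2 + y ^ 3 + y ^ 4) / 2"
      by (simp add: power2_eq_square power3_eq_cube power4_eq_xxxx field_simps)
    then show ?thesis using y by simp
  qed
  also have "\<dots> \<le> (1 - y + y\<^sup>2) * exp y"
    by (rule mult_left_mono[OF e]) (use assms y_def in \<open>simp add: abs_le_iff\<close>)
  finally have "exp (- y) \<le> 1 - y + y\<^sup>2" by (simp add: exp_minus field_simps)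
  then show ?thesis by (simp add: y_def)
qed

text \<open>A Hoeffding-type bound for a centred bounded variable: in
  \<open>exp x \<le> 1 + x + x\<^sup>2\<close> the linear term averages to zero.\<close>

lemma sum_exp_le:
  fixes p d :: "'b \<Rightarrow> real"
  assumes "\<And>j. j \<in> J \<Longrightarrow> p j \<ge> 0" "sum p J = 1" "(\<Sum>j\<in>J. p j * d j) = 0"
    and d: "\<And>j. j \<in> J \<Longrightarrow> \<bar>d j\<bar> \<le> c" and l: "\<bar>l\<bar> * c \<le> 1"
  shows "(\<Sum>j\<in>J. p j * exp (l * d j)) \<le> exp (l\<^sup>2 * c\<^sup>2)"
proof -
  have "(\<Sum>j\<in>J. p j * exp (l * d j)) \<le> (\<Sum>j\<in>J. p j + l * (p j * d j) + p j * (l\<^sup>2 * c\<^sup>2))"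
  proof (rule sum_mono)
    fix j assume j: "j \<in> J"
    have "\<bar>l * d j\<bar> \<le> \<bar>l\<bar> * c" unfolding abs_mult using d[OF j] by (intro mult_left_mono) auto
    then have "exp (l * d j) \<le> 1 + l * d j + (l * d j)\<^sup>2" using l by (intro exp_le_quadratic) auto
    also have "(l * d j)\<^sup>2 \<le> l\<^sup>2 * c\<^sup>2"
      unfolding power_mult_distrib using d[OF j] by (intro mult_left_mono abs_le_square_iff[THEN iffD1]) auto
    finally have "p j * exp (l * d j) \<le> p j * (1 + l * d j + l\<^sup>2 * c\<^sup>2)"
      using assms(1)[OF j] by (intro mult_left_mono) auto
    then show "p j * exp (l * d j) \<le> p j + l * (p j * d j) + p j * (l\<^sup>2 * c\<^sup>2)"
      by (simp add: algebra_simps)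
  qed
  also have "\<dots> = 1 + l\<^sup>2 * c\<^sup>2"
    using assms by (simp add: sum.distrib sum_distrib_left[symmetric] sum_distrib_right[symmetric])
  also have "\<dots> \<le> exp (l\<^sup>2 * c\<^sup>2)" by (rule exp_ge_add_one_self)
  finally show ?thesis .
qed

text \<open>After division, the means of \<open>f\<close> given \<open>i\<close> present and given
  \<open>i\<close> absent differ by at most 2. The monotone function \<open>F\<close> ignores
  \<open>i\<close>; it is at least \<open>f + k - 2\<close> on sets with \<open>i\<close> (one lost
  in \<open>f\<close>, one in the cardinality) and equals \<open>f + k\<close> on
  \<open>k\<close>-sets without \<open>i\<close>.\<close>

lemma conditioning_difference_le:
  assumes nd: "neg_dep V k w" and V: "finite V" and lip: "lip V f" and T: "T \<subseteq> V" "i \<in> V - T"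
  shows "(\<Sum>S\<in>slice V k (insert i T) {}. w S * f S) * sum w (slice V k T {i})
       - (\<Sum>S\<in>slice V k T {i}. w S * f S) * sum w (slice V k (insert i T) {})
       \<le> 2 * sum w (slice V k T {i}) * sum w (slice V k (insert i T) {})"
proof -
  define F where "F S = f (S - {i}) + real (card (S - {i}))" for S
  define z1 z0 where "z1 = sum w (slice V k (insert i T) {})" and "z0 = sum w (slice V k T {i})"
  define a1 a0 where "a1 = (\<Sum>S\<in>slice V k (insert i T) {}. w S * f S)" and "a0 = (\<Sum>S\<in>slice V k T {i}. w S * f S)"
  have wpos: "w S > 0" if "S \<in> slice V k A B" for S A B
    using that nd by (auto simp: slice_def intro: neg_dep_pos)
  have z: "z1 \<ge> 0" "z0 \<ge> 0" unfolding z1_def z0_def by (rule neg_dep_sum_nonneg[OF nd])+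
  have "(\<Sum>S\<in>slice V k (insert i T) {}. w S * F S) * sum w (slice V k T (insert i {}))
     \<le> (\<Sum>S\<in>slice V k T (insert i {}). w S * F S) * sum w (slice V k (insert i T) {})"
  proof (rule Feder_Mihail[OF nd V])
    show "F A \<le> F B" if "A \<subseteq> B" "B \<subseteq> V" for A B
      unfolding F_def by (rule lip_plus_card_mono[OF lip V]) (use that in auto)
    show "F (insert i S) = F S" for S by (simp add: F_def)
  qed (use T in auto)
  then have FM: "(\<Sum>S\<in>slice V k (insert i T) {}. w S * F S) * z0 \<le> (\<Sum>S\<in>slice V k T {i}. w S * F S) * z1"
    by (simp add: z1_def z0_def)
  have "a1 + (real k - 2) * z1 \<le> (\<Sum>S\<in>slice V k (insert i T) {}. w S * F S)"
    unfolding a1_def z1_def sum_distrib_left sum.distrib[symmetric]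
  proof (rule sum_mono)
    fix S assume S: "S \<in> slice V k (insert i T) {}"
    then have S': "S \<subseteq> V" "i \<in> S" "card S = k" "finite S" using finite_subset[OF _ V] by (auto simp: slice_def)
    then have "\<bar>f (insert i (S - {i})) - f (S - {i})\<bar> \<le> 1"
      by (intro lipD[OF lip]) auto
    moreover have "real (card (S - {i})) = real k - 1"
    proof -
      have "k > 0" using S' card_gt_0_iff by blast
      then show ?thesis using S' by (simp add: of_nat_diff)
    qed
    ultimately have "f S + (real k - 2) \<le> F S" using S' by (simp add: F_def insert_absorb abs_le_iff)
    then have "w S * (f S + (real k - 2)) \<le> w S * F S"
      using wpos[OF S] by (intro mult_left_mono) auto
    then show "w S * f S + (real k - 2) * w S \<le> w S * F S" by (simp only: distrib_left mult.commute)
  qed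
  then have "(a1 + (real k - 2) * z1) * z0 \<le> (\<Sum>S\<in>slice V k (insert i T) {}. w S * F S) * z0"
    using z(2) by (rule mult_right_mono)
  moreover have "(\<Sum>S\<in>slice V k T {i}. w S * F S) = a0 + real k * z0"
    unfolding a0_def z0_def sum_distrib_left sum.distrib[symmetric]
  proof (rule sum.cong)
    fix S assume S: "S \<in> slice V k T {i}"
    then have "S - {i} = S" "card S = k" by (auto simp: slice_def)
    then show "w S * F S = w S * f S + real k * w S" by (simp add: F_def algebra_simps)
  qed simp
  ultimately have "(a1 + (real k - 2) * z1) * z0 \<le> (a0 + real k * z0) * z1" using FM by simp
  then have "a1 * z0 - a0 * z1 \<le> 2 * z0 * z1" by (simp add: algebra_simps)
  then show ?thesis by (simp only: a1_def a0_def z1_def z0_def)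
qed

text \<open>The mean given \<open>T\<close> is a mixture of the means with \<open>i\<close> present
  and with \<open>i\<close> absent, so it is no further from the former than the latter is. The
  cross-multiplied form covers the case that every set contains \<open>i\<close>.\<close>

lemma avg_insert_diff_le:
  assumes nd: "neg_dep V k w" and V: "finite V" and lip: "lip V f" and T: "T \<subseteq> V" "i \<in> V - T"
    and "card T < k" "k \<le> card V"
  shows "\<bar>avg V k w f (insert i T) - avg V k w f T\<bar> \<le> 2"
proof -
  define z1 z0 where "z1 = sum w (slice V k (insert i T) {})" and "z0 = sum w (slice V k T {i})"
  define a1 a0 where "a1 = (\<Sum>S\<in>slice V k (insert i T) {}. w S * f S)" and "a0 = (\<Sum>S\<in>slice V k T {i}. w S * f S)"
  have "finite T" by (rule finite_subset[OF T(1) V])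
  then have z1: "z1 > 0" unfolding z1_def
    using assms by (intro neg_dep_sum_pos[OF nd V]) auto
  have z0: "z0 \<ge> 0" unfolding z0_def by (rule neg_dep_sum_nonneg[OF nd])
  have "a1 * z0 - a0 * z1 \<le> 2 * z0 * z1"
    using conditioning_difference_le[OF nd V lip T] by (simp add: a1_def a0_def z1_def z0_def)
  moreover have "- (a1 * z0 - a0 * z1) \<le> 2 * z0 * z1"
    using conditioning_difference_le[OF nd V lip_uminus[OF lip] T]
    by (simp add: a1_def a0_def z1_def z0_def sum_negf)
  ultimately have "\<bar>a1 * z0 - a0 * z1\<bar> \<le> 2 * z0 * z1" by linarith
  also have "\<dots> \<le> 2 * (z1 * (z1 + z0))" using z1 z0 by (simp add: algebra_simps)
  finally have le: "\<bar>a1 * z0 - a0 * z1\<bar> \<le> 2 * (z1 * (z1 + z0))" .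
  have "avg V k w f (insert i T) - avg V k w f T = a1 / z1 - (a1 + a0) / (z1 + z0)"
    unfolding avg_def sum_slice_split[OF V, of _ k T "{}" i] a1_def a0_def z1_def z0_def by simp
  also have "\<dots> = (a1 * z0 - a0 * z1) / (z1 * (z1 + z0))"
    using z1 z0 by (simp add: field_simps)
  finally show ?thesis using le z1 z0 by (simp add: abs_divide divide_le_eq abs_mult)
qed

text \<open>Revealing the elements of the random set one by one in uniformly random order makes the
  conditional averages a martingale with increments at most \<open>2\<close>.\<close>

lemma homogeneous_mgf:
  assumes nd: "neg_dep V k w" and V: "finite V" and lip: "lip V f" and "k \<le> card V"
    and l: "\<bar>l\<bar> * 2 \<le> 1"
    and "T \<subseteq> V" "card T \<le> k"
  shows "(\<Sum>S\<in>slice V k T {}. w S * exp (l * f S))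
      \<le> sum w (slice V k T {}) * exp (l * avg V k w f T + 4 * l\<^sup>2 * (real k - real (card T)))"
  using assms(6-)
proof (induction "k - card T" arbitrary: T)
  case 0
  have kT: "card T = k" using 0 by linarith
  have "S = T" if "S \<subseteq> V" "card S = k" "T \<subseteq> S" for S
    using card_subset_eq[OF finite_subset[OF that(1) V] that(3)] that(2) kT by simp
  then have "slice V k T {} = {T}" using 0(2) kT by (auto simp: slice_def)
  moreover have "w T > 0" by (rule neg_dep_pos[OF nd 0(2) kT])
  moreover note kT
  ultimately show ?case by (simp add: avg_def)
next
  case (Suc d)
  define t where "t = real k - real (card T)"
  have t: "t > 0" using Suc.hyps(2) by (simp add: t_def)
  have fT: "finite T" by (rule finite_subset[OF Suc.prems(1) V])
  define Z where "Z = sum w (slice V k T {})"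
  have Z: "Z > 0" unfolding Z_def using Suc.prems assms(4) by (intro neg_dep_sum_pos[OF nd V]) auto
  \<comment> \<open>The law of the next revealed element: draw \<open>S\<close> from the conditional
    measure, then a uniform element of the \<open>t\<close> elements of
    \<open>S - T\<close>.\<close>
  define p where "p j = sum w (slice V k (insert j T) {}) / (t * Z)" for j
  define e where "e = avg V k w f T"
  define ej where "ej j = avg V k w f (insert j T)" for j
  note dc = sum_slice_double_count[OF V Suc.prems(1), of "{}" _ k, simplified, folded t_def]
  have Zj: "sum w (slice V k (insert j T) {}) > 0" if "j \<in> V - T" for j
    using Suc.hyps(2) Suc.prems that fT assms(4) by (intro neg_dep_sum_pos[OF nd V]) auto
  have pj: "p j > 0" if "j \<in> V - T" for j using Zj[OF that] t Z by (simp add: p_def)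
  have p1: "sum p (V - T) = 1"
    unfolding p_def sum_divide_distrib[symmetric] dc using t Z by (simp add: Z_def)
  \<comment> \<open>The martingale property, again by double counting.\<close>
  have pe: "(\<Sum>j\<in>V - T. p j * ej j) = e"
  proof -
    have "(\<Sum>j\<in>V - T. p j * ej j) = (\<Sum>j\<in>V - T. (\<Sum>S\<in>slice V k (insert j T) {}. w S * f S)) / (t * Z)"
      unfolding sum_divide_distrib[of _ "V - T"]
    proof (rule sum.cong)
      fix j assume j: "j \<in> V - T"
      show "p j * ej j = (\<Sum>S\<in>slice V k (insert j T) {}. w S * f S) / (t * Z)"
        using Zj[OF j] by (simp add: p_def ej_def avg_def)
    qed simp
    also have "\<dots> = e" unfolding dc using t Z by (simp add: e_def avg_def Z_def)
    finally show ?thesis .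
  qed
  have IH: "(\<Sum>S\<in>slice V k (insert j T) {}. w S * exp (l * f S))
      \<le> (t * Z) * (p j * exp (l * (ej j - e))) * exp (l * e + 4 * l\<^sup>2 * (t - 1))" if j: "j \<in> V - T" for j
  proof -
    have c: "card (insert j T) = Suc (card T)" using j fT by simp
    have hy: "d = k - card (insert j T)" "card (insert j T) \<le> k" using Suc.hyps(2) c by linarith+
    have "(\<Sum>S\<in>slice V k (insert j T) {}. w S * exp (l * f S))
      \<le> sum w (slice V k (insert j T) {}) * exp (l * ej j + 4 * l\<^sup>2 * (real k - real (card (insert j T))))"
      unfolding ej_def by (rule Suc.hyps(1)[OF hy(1) _ hy(2)]) (use Suc.prems(1) j in auto)
    also have "l * ej j + 4 * l\<^sup>2 * (real k - real (card (insert j T))) = l * (ej j - e) + (l * e + 4 * l\<^sup>2 * (t - 1))"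
      unfolding c t_def by (simp add: algebra_simps)
    also have "sum w (slice V k (insert j T) {}) = (t * Z) * p j" using t Z by (simp add: p_def)
    finally show ?thesis by (simp add: exp_add mult_ac)
  qed
  have "t * (\<Sum>S\<in>slice V k T {}. w S * exp (l * f S)) = (\<Sum>j\<in>V - T. \<Sum>S\<in>slice V k (insert j T) {}. w S * exp (l * f S))"
    by (rule dc[symmetric])
  also have "\<dots> \<le> (\<Sum>j\<in>V - T. (t * Z) * (p j * exp (l * (ej j - e))) * exp (l * e + 4 * l\<^sup>2 * (t - 1)))"
    by (rule sum_mono) (rule IH)
  also have "\<dots> = (t * Z) * exp (l * e + 4 * l\<^sup>2 * (t - 1)) * (\<Sum>j\<in>V - T. p j * exp (l * (ej j - e)))"
    unfolding sum_distrib_left by (simp only: mult_ac)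
  \<comment> \<open>One revealed element costs the factor
    \<open>exp (l\<^sup>2 * 2\<^sup>2)\<close>, which restores the \<open>4 * l\<^sup>2\<close> by
    which the exponent with \<open>t - 1\<close> falls short.\<close>
  also have "\<dots> \<le> (t * Z) * exp (l * e + 4 * l\<^sup>2 * (t - 1)) * exp (l\<^sup>2 * 2\<^sup>2)"
  proof (rule mult_left_mono)
    show "(\<Sum>j\<in>V - T. p j * exp (l * (ej j - e))) \<le> exp (l\<^sup>2 * 2\<^sup>2)"
    proof (rule sum_exp_le)
      show "(\<Sum>j\<in>V - T. p j * (ej j - e)) = 0"
        using p1 pe by (simp add: right_diff_distrib sum_subtractf sum_distrib_right[symmetric])
      show "\<bar>ej j - e\<bar> \<le> 2" if "j \<in> V - T" for j
        unfolding ej_def e_def by (rule avg_insert_diff_le[OF nd V lip]) (use Suc.hyps(2) Suc.prems that assms(4) in auto)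
      show "p j \<ge> 0" if "j \<in> V - T" for j using pj[OF that] by simp
    qed (use p1 l in auto)
  qed (use t Z in auto)
  also have "\<dots> = t * (Z * (exp (l * e + 4 * l\<^sup>2 * (t - 1)) * exp (l\<^sup>2 * 2\<^sup>2)))"
    by (simp only: mult.assoc)
  also have "exp (l * e + 4 * l\<^sup>2 * (t - 1)) * exp (l\<^sup>2 * 2\<^sup>2) = exp (l * e + 4 * l\<^sup>2 * t)"
    unfolding exp_add[symmetric] by (simp add: algebra_simps)
  finally have "(\<Sum>S\<in>slice V k T {}. w S * exp (l * f S)) \<le> Z * exp (l * e + 4 * l\<^sup>2 * t)"
    by (simp only: mult_le_cancel_left_pos[OF t])
  then show ?case by (simp only: t_def Z_def e_def)
qed

section \<open>Comparison of consecutive layers\<close>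

text \<open>Apply the Feder--Mihail argument to the generating polynomial multiplied by \<open>1 + z\<^sub>v\<close>, whose
  layer of degree \<open>k + 1\<close> glues the layers \<open>k\<close> and \<open>k + 1\<close> of the original one.\<close>

lemma layer_difference_le:
  assumes V: "finite V" "v \<notin> V" and nd: "neg_dep (insert v V) (Suc k) (\<lambda>S. w (S - {v}))" and lip: "lip V f"
  shows "(\<Sum>S\<in>slice V k {} {}. w S * f S) * sum w (slice V (Suc k) {} {})
       - (\<Sum>S\<in>slice V (Suc k) {} {}. w S * f S) * sum w (slice V k {} {})
       \<le> sum w (slice V k {} {}) * sum w (slice V (Suc k) {} {})"
proof -
  \<comment> \<open>The sets with \<open>v\<close> have \<open>k\<close> old elements and those
    without it have \<open>Suc k\<close>, so the cardinality terms differ by one; this is where the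
    constant 1 comes from.\<close>
  define F where "F S = f (S - {v}) + real (card (S - {v}))" for S
  have img: "slice (insert v V) (Suc k) {v} {} = insert v ` slice V k {} {}"
  proof (intro equalityI subsetI)
    fix S assume S: "S \<in> slice (insert v V) (Suc k) {v} {}"
    then have "finite S" "v \<in> S" using finite_subset[of S "insert v V"] V by (auto simp: slice_def)
    then have "S = insert v (S - {v})" "S - {v} \<in> slice V k {} {}" using S by (auto simp: slice_def)
    then show "S \<in> insert v ` slice V k {} {}" by blast
  next
    fix S assume "S \<in> insert v ` slice V k {} {}"
    then obtain S0 where S0: "S = insert v S0" "S0 \<subseteq> V" "card S0 = k" by (auto simp: slice_def)
    then have "finite S0" "v \<notin> S0" using finite_subset V by auto
    then show "S \<in> slice (insert v V) (Suc k) {v} {}" using S0 by (auto simp: slice_def)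
  qed
  have inj: "inj_on (insert v) (slice V k {} {})" using V by (auto simp: inj_on_def slice_def)
  have s1: "sum h (slice (insert v V) (Suc k) {v} {}) = (\<Sum>S\<in>slice V k {} {}. h (insert v S))" for h :: "'a set \<Rightarrow> real"
    unfolding img by (simp add: sum.reindex[OF inj])
  have s0: "slice (insert v V) (Suc k) {} {v} = slice V (Suc k) {} {}"
    using V by (auto simp: slice_def)
  have nv: "S - {v} = S" if "S \<in> slice V m {} {}" for S m using that V by (auto simp: slice_def)
  have "(\<Sum>S\<in>slice (insert v V) (Suc k) (insert v {}) {}. w (S - {v}) * F S) * (\<Sum>S\<in>slice (insert v V) (Suc k) {} (insert v {}). w (S - {v}))
     \<le> (\<Sum>S\<in>slice (insert v V) (Suc k) {} (insert v {}). w (S - {v}) * F S) * (\<Sum>S\<in>slice (insert v V) (Suc k) (insert v {}) {}. w (S - {v}))"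
  proof (rule Feder_Mihail[OF nd])
    show "F A \<le> F B" if "A \<subseteq> B" "B \<subseteq> insert v V" for A B
      unfolding F_def by (rule lip_plus_card_mono[OF lip V(1)]) (use that in auto)
    show "F (insert v S) = F S" for S by (simp add: F_def)
  qed (use V in auto)
  moreover have "(\<Sum>S\<in>slice V k {} {}. w (insert v S - {v}) * F (insert v S)) =
    (\<Sum>S\<in>slice V k {} {}. w S * f S) + real k * sum w (slice V k {} {})"
    unfolding sum_distrib_left sum.distrib[symmetric]
    by (rule sum.cong) (use nv in \<open>auto simp: F_def slice_def algebra_simps\<close>)
  moreover have "(\<Sum>S\<in>slice V k {} {}. w (insert v S - {v})) = sum w (slice V k {} {})"
    by (rule sum.cong) (use nv in auto)
  moreover have "(\<Sum>S\<in>slice V (Suc k) {} {}. w (S - {v}) * F S) =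
    (\<Sum>S\<in>slice V (Suc k) {} {}. w S * f S) + real (Suc k) * sum w (slice V (Suc k) {} {})"
    unfolding sum_distrib_left sum.distrib[symmetric]
    by (rule sum.cong) (use nv in \<open>auto simp: F_def slice_def algebra_simps\<close>)
  moreover have "(\<Sum>S\<in>slice V (Suc k) {} {}. w (S - {v})) = sum w (slice V (Suc k) {} {})"
    by (rule sum.cong) (use nv in auto)
  ultimately show ?thesis by (simp add: s1 s0 algebra_simps)
qed

lemma avg_layer_diff_le:
  assumes V: "finite V" "v \<notin> V" and nd: "neg_dep (insert v V) (Suc k) (\<lambda>S. w (S - {v}))" and lip: "lip V f"
    and pos: "sum w (slice V k {} {}) > 0" "sum w (slice V (Suc k) {} {}) > 0"
  shows "\<bar>avg V (Suc k) w f {} - avg V k w f {}\<bar> \<le> 1"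
proof -
  define z1 z0 where "z1 = sum w (slice V (Suc k) {} {})" and "z0 = sum w (slice V k {} {})"
  define a1 a0 where "a1 = (\<Sum>S\<in>slice V (Suc k) {} {}. w S * f S)" and "a0 = (\<Sum>S\<in>slice V k {} {}. w S * f S)"
  have "a0 * z1 - a1 * z0 \<le> z0 * z1"
    using layer_difference_le[OF V nd lip] by (simp add: a1_def a0_def z1_def z0_def)
  moreover have "- (a0 * z1 - a1 * z0) \<le> z0 * z1"
    using layer_difference_le[OF V nd lip_uminus[OF lip]]
    by (simp add: a1_def a0_def z1_def z0_def sum_negf)
  ultimately have "\<bar>a1 * z0 - a0 * z1\<bar> \<le> z0 * z1" by linarith
  moreover have z: "z0 > 0" "z1 > 0" using pos by (simp_all only: z1_def z0_def)
  moreover have "avg V (Suc k) w f {} - avg V k w f {} = a1 / z1 - a0 / z0"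
    by (simp only: avg_def a1_def a0_def z1_def z0_def)
  moreover have "a1 / z1 - a0 / z0 = (a1 * z0 - a0 * z1) / (z0 * z1)"
    using z by (simp add: field_simps)
  ultimately show ?thesis by (simp add: abs_divide divide_le_eq abs_mult)
qed


section \<open>Real-rooted polynomials as sums of Bernoulli variables\<close>

text \<open>The coefficients are read as an unnormalized law on the naturals, and
  \<open>coeff_sum p h\<close> as the unnormalized expectation of \<open>h\<close>.\<close>

definition coeff_sum :: "real poly \<Rightarrow> (nat \<Rightarrow> real) \<Rightarrow> real" where
  "coeff_sum p h = (\<Sum>k\<le>degree p. coeff p k * h k)"

lemma coeff_sum_eq: "degree p \<le> n \<Longrightarrow> coeff_sum p h = (\<Sum>k\<le>n. coeff p k * h k)"
  unfolding coeff_sum_def by (rule sum.mono_neutral_left) (auto simp: coeff_eq_0)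

text \<open>For \<open>r \<ge> 0\<close> the factor adds an independent Bernoulli variable with
  weights \<open>r\<close> for 0 and 1 for 1; the right side averages over it first.\<close>

lemma coeff_sum_linear_factor:
  "coeff_sum ([:r, 1:] * q) h = coeff_sum q (\<lambda>k. r * h k + h (Suc k))"
proof -
  define n where "n = degree q"
  have deg: "degree ([:r, 1:] * q) \<le> Suc n"
    using degree_mult_le[of "[:r, 1:]" q] by (simp add: n_def)
  have c: "coeff ([:r, 1:] * q) k = r * coeff q k + coeff (pCons 0 q) k" for k by simp
  have "coeff_sum ([:r, 1:] * q) h = (\<Sum>k\<le>Suc n. coeff ([:r, 1:] * q) k * h k)"
    by (rule coeff_sum_eq[OF deg])
  also have "\<dots> = (\<Sum>k\<le>Suc n. r * coeff q k * h k) + (\<Sum>k\<le>Suc n. coeff (pCons 0 q) k * h k)"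
    unfolding c by (simp only: distrib_right sum.distrib)
  also have "(\<Sum>k\<le>Suc n. r * coeff q k * h k) = (\<Sum>k\<le>n. r * coeff q k * h k)"
    by (simp add: n_def coeff_eq_0)
  also have "(\<Sum>k\<le>Suc n. coeff (pCons 0 q) k * h k) = (\<Sum>k\<le>n. coeff q k * h (Suc k))"
    by (subst sum.atMost_Suc_shift) simp
  finally show ?thesis
    by (simp add: coeff_sum_def n_def sum.distrib[symmetric] algebra_simps)
qed

lemma coeff_sum_mono:
  "(\<And>k. coeff p k \<ge> 0) \<Longrightarrow> (\<And>k. h k \<le> h' k) \<Longrightarrow> coeff_sum p h \<le> coeff_sum p h'"
  unfolding coeff_sum_def by (intro sum_mono mult_left_mono)

lemma coeff_sum_cmult: "coeff_sum p (\<lambda>k. c * h k) = c * coeff_sum p h"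
  unfolding coeff_sum_def by (simp add: sum_distrib_left mult_ac)

lemma coeff_sum_add: "coeff_sum p (\<lambda>k. h k + h' k) = coeff_sum p h + coeff_sum p h'"
  unfolding coeff_sum_def by (simp add: distrib_left sum.distrib)

lemma coeff_sum_one: "coeff_sum p (\<lambda>k. 1) = poly p 1"
  unfolding coeff_sum_def by (simp add: poly_altdef)

text \<open>The variance of the two-point law is at most \<open>L\<^sup>2\<close> times the success
  probability \<open>1 / (1 + r)\<close>. Keeping this probability makes the errors of all Bernoulli
  variables add up to a multiple of the mean.\<close>

lemma two_point_exp_le:
  fixes r a b L :: real
  assumes r: "r \<ge> 0" and d: "\<bar>b - a\<bar> \<le> L" "L \<le> 1"
  shows "r * exp a + exp b \<le> (1 + r) * exp ((r * a + b) / (1 + r) + L\<^sup>2 / (1 + r))"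
proof -
  define q where "q = 1 / (1 + r)"
  define m where "m = (r * a + b) / (1 + r)"
  define D where "D = b - a"
  have q: "q > 0" "q \<le> 1" "(1 + r) * q = 1" using r by (auto simp: q_def)
  have rq: "r * q = 1 - q" using q(3) by (simp add: algebra_simps)
  have m: "a = m + - D * q" "b = m + D * (1 - q)"
  proof -
    have "m = (r * q) * a + q * b" by (simp add: m_def q_def add_divide_distrib)
    then show "a = m + - D * q" "b = m + D * (1 - q)" unfolding rq D_def by (simp_all add: algebra_simps)
  qed
  have D: "\<bar>D\<bar> \<le> 1" "D\<^sup>2 \<le> L\<^sup>2" using d by (auto simp: D_def abs_le_square_iff[symmetric])
  have "\<bar>- D * q\<bar> \<le> 1 * 1" unfolding abs_mult using D q by (intro mult_mono) auto
  then have e1: "exp (- D * q) \<le> 1 + - D * q + (- D * q)\<^sup>2" by (intro exp_le_quadratic) simp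
  have "\<bar>D * (1 - q)\<bar> \<le> 1 * 1" unfolding abs_mult using D q by (intro mult_mono) auto
  then have e2: "exp (D * (1 - q)) \<le> 1 + D * (1 - q) + (D * (1 - q))\<^sup>2" by (intro exp_le_quadratic) simp
  have "(1 - q) * exp (- D * q) + q * exp (D * (1 - q))
      \<le> (1 - q) * (1 + - D * q + (- D * q)\<^sup>2) + q * (1 + D * (1 - q) + (D * (1 - q))\<^sup>2)"
    using q by (intro add_mono mult_left_mono e1 e2) auto
  also have "\<dots> = 1 + D\<^sup>2 * (q * (1 - q))" by (simp add: power2_eq_square algebra_simps)
  also have "D\<^sup>2 * (q * (1 - q)) \<le> L\<^sup>2 * (q * 1)"
    using D q by (intro mult_mono) auto
  also have "1 + L\<^sup>2 * (q * 1) \<le> exp (L\<^sup>2 * q)" using exp_ge_add_one_self by simp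
  finally have "(1 - q) * exp (- D * q) + q * exp (D * (1 - q)) \<le> exp (L\<^sup>2 * q)" by simp
  then have "(1 + r) * exp m * ((1 - q) * exp (- D * q) + q * exp (D * (1 - q))) \<le> (1 + r) * exp m * exp (L\<^sup>2 * q)"
    using r by (intro mult_left_mono) auto
  moreover have "(1 + r) * (1 - q) = r" "(1 + r) * q = 1" using q(3) by (simp_all add: algebra_simps)
  moreover have "(1 + r) * exp m * ((1 - q) * exp (- D * q) + q * exp (D * (1 - q)))
     = ((1 + r) * (1 - q)) * (exp m * exp (- D * q)) + ((1 + r) * q) * (exp m * exp (D * (1 - q)))"
    by (simp only: distrib_left mult_ac)
  ultimately have "r * exp (m + - D * q) + exp (m + D * (1 - q)) \<le> (1 + r) * exp (m + L\<^sup>2 * q)"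
    by (simp only: exp_add mult_1_left mult.assoc)
  then show ?thesis unfolding m[symmetric] by (simp add: m_def q_def)
qed

text \<open>A real-rooted polynomial with nonnegative coefficients is, after normalization, the generating
  polynomial of a sum of independent Bernoulli variables; the induction peels off one of them.\<close>

lemma real_rooted_mgf:
  fixes p :: "real poly"
  assumes "\<And>z :: complex. poly (map_poly of_real p) z = 0 \<Longrightarrow> Im z = 0 \<and> Re z \<le> 0" and "poly p 1 > 0"
  shows "(\<forall>k. coeff p k \<ge> 0) \<and>
    (\<forall>g L. (\<forall>k. \<bar>g (Suc k) - g k\<bar> \<le> L) \<longrightarrow> L \<le> 1 \<longrightarrow>
      coeff_sum p (\<lambda>k. exp (g k)) \<le> poly p 1 * exp ((coeff_sum p g + L\<^sup>2 * coeff_sum p real) / poly p 1))"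
  using assms
proof (induction "degree p" arbitrary: p)
  case 0
  then obtain c where p: "p = [:c:]" by (metis degree_eq_zeroE)
  then have "c > 0" using 0 by simp
  then show ?case unfolding p by (auto simp: coeff_sum_def coeff_pCons split: nat.split)
next
  case (Suc d)
  have "degree (map_poly complex_of_real p) = Suc d"
    using Suc.hyps(2) by (subst degree_map_poly) auto
  then have "\<not> constant (poly (map_poly complex_of_real p))" by (simp add: constant_degree)
  then obtain z where z: "poly (map_poly complex_of_real p) z = 0"
    using fundamental_theorem_of_algebra by blast
  define r where "r = - Re z"
  have r: "r \<ge> 0" and zr: "z = complex_of_real (- r)"
    using Suc.prems(1)[OF z] by (auto simp: r_def complex_eq_iff)
  have "complex_of_real (poly p (- r)) = 0"
    using z unfolding zr by (simp add: poly_altdef degree_map_poly coeff_map_poly)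
  then have "poly p (- r) = 0" using of_real_eq_0_iff by blast
  then obtain q where q: "p = [:r, 1:] * q" by (metis dvdE poly_eq_0_iff_dvd minus_minus)
  have "p \<noteq> 0" using Suc.hyps(2) by auto
  then have "q \<noteq> 0" using q by auto
  then have dq: "d = degree q" using Suc.hyps(2) unfolding q by (subst (asm) degree_mult_eq) auto
  have p1: "poly p 1 = (1 + r) * poly q 1" unfolding q by (simp add: algebra_simps)
  have q1: "poly q 1 > 0" using Suc.prems(2) r unfolding p1 by (simp add: zero_less_mult_iff)
  have mp: "map_poly complex_of_real p = [:complex_of_real r, 1:] * map_poly complex_of_real q"
    unfolding q by (rule poly_eqI) (simp add: coeff_map_poly coeff_pCons split: nat.split)
  have "\<And>z. poly (map_poly complex_of_real q) z = 0 \<Longrightarrow> Im z = 0 \<and> Re z \<le> 0"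
    by (rule Suc.prems(1)) (simp add: mp)
  note IH = Suc.hyps(1)[OF dq this q1]
  then have cq: "\<And>k. coeff q k \<ge> 0" by blast
  have cp: "coeff p k \<ge> 0" for k
    unfolding q using r cq by (auto simp: coeff_pCons split: nat.split)
  have "coeff_sum p (\<lambda>k. exp (g k)) \<le> poly p 1 * exp ((coeff_sum p g + L\<^sup>2 * coeff_sum p real) / poly p 1)"
    if g: "\<forall>k. \<bar>g (Suc k) - g k\<bar> \<le> L" and L: "L \<le> 1" for g L
  proof -
    \<comment> \<open>The mean of \<open>g\<close> over the peeled-off Bernoulli variable; as an
      average of shifts it keeps the increment bound \<open>L\<close>.\<close>
    define g' where "g' k = (r * g k + g (Suc k)) / (1 + r)" for k
    have "\<bar>g' (Suc k) - g' k\<bar> \<le> L" for k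
    proof -
      have "\<bar>r * (g (Suc k) - g k) + (g (Suc (Suc k)) - g (Suc k))\<bar> \<le> r * L + L"
        using g r by (intro order_trans[OF abs_triangle_ineq] add_mono) (auto simp: abs_mult intro: mult_left_mono)
      moreover have "g' (Suc k) - g' k = (r * (g (Suc k) - g k) + (g (Suc (Suc k)) - g (Suc k))) / (1 + r)"
        unfolding g'_def diff_divide_distrib[symmetric] by (simp add: algebra_simps)
      ultimately show ?thesis using r by (simp add: abs_divide divide_le_eq algebra_simps)
    qed
    then have IHg: "coeff_sum q (\<lambda>k. exp (g' k)) \<le> poly q 1 * exp ((coeff_sum q g' + L\<^sup>2 * coeff_sum q real) / poly q 1)"
      using IH L by blast
    have "coeff_sum p (\<lambda>k. exp (g k)) = coeff_sum q (\<lambda>k. r * exp (g k) + exp (g (Suc k)))"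
      unfolding q by (rule coeff_sum_linear_factor)
    also have "\<dots> \<le> coeff_sum q (\<lambda>k. ((1 + r) * exp (L\<^sup>2 / (1 + r))) * exp (g' k))"
    proof (rule coeff_sum_mono[OF cq])
      fix k
      have "r * exp (g k) + exp (g (Suc k)) \<le> (1 + r) * exp (g' k + L\<^sup>2 / (1 + r))"
        unfolding g'_def by (rule two_point_exp_le) (use r g L in auto)
      then show "r * exp (g k) + exp (g (Suc k)) \<le> ((1 + r) * exp (L\<^sup>2 / (1 + r))) * exp (g' k)"
        by (simp only: exp_add mult_ac)
    qed
    also have "\<dots> = ((1 + r) * exp (L\<^sup>2 / (1 + r))) * coeff_sum q (\<lambda>k. exp (g' k))"
      by (rule coeff_sum_cmult)
    also have "\<dots> \<le> ((1 + r) * exp (L\<^sup>2 / (1 + r))) * (poly q 1 * exp ((coeff_sum q g' + L\<^sup>2 * coeff_sum q real) / poly q 1))"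
      using r by (intro mult_left_mono IHg) auto
    also have "\<dots> = poly p 1 * exp (L\<^sup>2 / (1 + r) + (coeff_sum q g' + L\<^sup>2 * coeff_sum q real) / poly q 1)"
      unfolding p1 exp_add by (simp only: mult_ac)
    \<comment> \<open>The mean of \<open>g\<close> is preserved by the averaging, and
      \<open>1 / (1 + r)\<close> is the mean of the removed variable, so the means add.\<close>
    also have "L\<^sup>2 / (1 + r) + (coeff_sum q g' + L\<^sup>2 * coeff_sum q real) / poly q 1 = (coeff_sum p g + L\<^sup>2 * coeff_sum p real) / poly p 1"
    proof -
      have "coeff_sum p g = coeff_sum q (\<lambda>k. (1 + r) * g' k)"
        unfolding q coeff_sum_linear_factor using r by (simp add: g'_def)
      then have 1: "coeff_sum p g = (1 + r) * coeff_sum q g'" by (simp only: coeff_sum_cmult)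
      have "coeff_sum p real = coeff_sum q (\<lambda>k. (1 + r) * real k + 1)"
        unfolding q coeff_sum_linear_factor by (simp add: algebra_simps)
      then have 2: "coeff_sum p real = (1 + r) * coeff_sum q real + poly q 1"
        by (simp only: coeff_sum_add coeff_sum_cmult coeff_sum_one)
      show ?thesis unfolding 1 2 p1 using r q1 by (simp add: field_simps)
    qed
    finally show ?thesis .
  qed
  then show ?case using cp by blast
qed

section \<open>Exponential moments of stable weights\<close>

lemma sum_Pow_slices:
  fixes h :: "'a set \<Rightarrow> real"
  assumes "finite V"
  shows "sum h (Pow V) = (\<Sum>k\<le>card V. sum h (slice V k {} {}))"
proof -
  have "(\<Sum>k\<in>{..card V}. sum h {S\<in>Pow V. card S = k}) = sum h (Pow V)"
    by (rule sum.group) (use assms in \<open>auto intro: card_mono\<close>)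
  moreover have "{S\<in>Pow V. card S = k} = slice V k {} {}" for k by (auto simp: slice_def)
  ultimately show ?thesis by simp
qed

text \<open>Two stages: given size \<open>k\<close>, the martingale bounds the exponential moment by
  \<open>exp (l * e k + 4 * l\<^sup>2 * k)\<close>; then the Bernoulli bound is applied to this
  exponent as a function of \<open>k\<close>. The constant 7 is 4 from the first stage plus 3 from
  the second.\<close>

lemma stable_mgf_pos:
  assumes V: "finite V" "v \<notin> V" and st: "stable_weight V w" and w: "\<And>S. w S > 0"
    and lip: "lip V f" and l: "\<bar>l\<bar> \<le> 1 / 8"
  shows "(\<Sum>S\<in>Pow V. w S * exp (l * f S)) \<le> sum w (Pow V) *
    exp ((l * (\<Sum>S\<in>Pow V. w S * f S) + 7 * l\<^sup>2 * (\<Sum>S\<in>Pow V. w S * real (card S))) / sum w (Pow V))"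
proof -
  define n where "n = card V"
  define \<rho> where "\<rho> k = sum w (slice V k {} {})" for k
  define p where "p = (\<Sum>k\<le>n. monom (\<rho> k) k)"
  define e where "e k = avg V k w f {}" for k
  have cp: "coeff p k = (if k \<le> n then \<rho> k else 0)" for k
    by (simp add: p_def coeff_sum)
  have degp: "degree p \<le> n" by (rule degree_le) (simp add: cp)
  have cs: "coeff_sum p h = (\<Sum>k\<le>n. \<rho> k * h k)" for h
    unfolding coeff_sum_eq[OF degp] by (simp add: cp)
  have \<rho>: "\<rho> k > 0" if "k \<le> n" for k
    unfolding \<rho>_def
  proof (rule sum_pos)
    show "slice V k {} {} \<noteq> {}" by (rule slice_nonempty) (use V that in \<open>auto simp: n_def\<close>)
  qed (use V w in auto)
  have Z: "sum w (Pow V) = poly p 1"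
    unfolding coeff_sum_one[symmetric] cs sum_Pow_slices[OF V(1)] by (simp add: \<rho>_def n_def)
  have Zpos: "poly p 1 > 0" unfolding Z[symmetric] by (rule sum_pos) (use V w in auto)
  \<comment> \<open>On the diagonal the generating polynomial becomes \<open>p\<close>. Stability
    excludes roots in both open half planes, positive coefficients exclude positive ones.\<close>
  have roots: "Im z = 0 \<and> Re z \<le> 0" if z: "poly (map_poly complex_of_real p) z = 0" for z
  proof -
    have "poly (map_poly complex_of_real p) z = (\<Sum>k\<le>n. complex_of_real (coeff p k) * z ^ k)"
    proof -
      have d: "degree (map_poly complex_of_real p) = degree p" by (subst degree_map_poly) auto
      show ?thesis unfolding poly_altdef d
        by (rule sum.mono_neutral_cong_left) (use degp in \<open>auto simp: coeff_map_poly coeff_eq_0\<close>)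
    qed
    also have "\<dots> = set_poly V w (\<lambda>_. z)"
    proof -
      have "set_poly V w (\<lambda>_. z) = (\<Sum>k\<le>n. \<Sum>S\<in>{S\<in>Pow V. card S = k}. complex_of_real (w S) * z ^ card S)"
        unfolding set_poly_def n_def by (subst sum.group) (use V in \<open>auto intro: card_mono\<close>)
      also have "\<dots> = (\<Sum>k\<le>n. complex_of_real (coeff p k) * z ^ k)"
      proof (rule sum.cong)
        fix k assume "k \<in> {..n}"
        then have "coeff p k = sum w {S\<in>Pow V. card S = k}"
          by (simp add: cp \<rho>_def slice_def Pow_def conj_commute)
        then show "(\<Sum>S\<in>{S\<in>Pow V. card S = k}. complex_of_real (w S) * z ^ card S) = complex_of_real (coeff p k) * z ^ k"
          by (simp add: sum_distrib_right)
      qed simp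
      finally show ?thesis by simp
    qed
    finally have s: "set_poly V w (\<lambda>_. z) = 0" using z by simp
    have "\<not> Im z > 0" using stable_weightD[OF st, of "\<lambda>_. z"] s by auto
    moreover have "\<not> Im z < 0" using stable_lower[OF st, of "\<lambda>_. z"] s by auto
    ultimately have im: "Im z = 0" by linarith
    then have "z = complex_of_real (Re z)" by (simp add: complex_eq_iff)
    then have "\<not> Re z > 0" using set_poly_pos[of V w "\<lambda>_. Re z"] V w s by auto
    then show ?thesis using im by simp
  qed
  have nd: "neg_dep V k w" if "k \<le> n" for k
    by (rule stable_layer_imp_neg_dep[OF V(1) w]) (use stable_layer[OF st V(1) w] that in \<open>simp add: n_def\<close>)
  have e_diff: "\<bar>e (Suc k) - e k\<bar> \<le> 1" if k: "Suc k \<le> n" for k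
    unfolding e_def
  proof (rule avg_layer_diff_le[OF V _ lip])
    have fin: "finite (insert v V)" using V by simp
    have st': "stable_weight (insert v V) (\<lambda>S. w (S - {v}))" by (rule stable_insert[OF st V])
    have "stable_weight (insert v V) (layer (Suc k) (\<lambda>S. w (S - {v})))"
      by (rule stable_layer[OF st' fin w]) (use V k in \<open>simp add: n_def\<close>)
    then show "neg_dep (insert v V) (Suc k) (\<lambda>S. w (S - {v}))"
      by (rule stable_layer_imp_neg_dep[OF fin w])
    show "0 < sum w (slice V k {} {})" "0 < sum w (slice V (Suc k) {} {})"
      using \<rho>[of k] \<rho>[of "Suc k"] k by (simp_all add: \<rho>_def)
  qed
  \<comment> \<open>Frozen beyond \<open>n\<close>, where the coefficients of \<open>p\<close>
    vanish, so that the increment bound holds for every \<open>k\<close>.\<close>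
  define g where "g k = l * e (min k n) + 4 * l\<^sup>2 * real (min k n)" for k
  define L where "L = \<bar>l\<bar> + 4 * l\<^sup>2"
  \<comment> \<open>From \<open>\<bar>l\<bar> \<le> 1 / 8\<close> the term
    \<open>4 * l\<^sup>2\<close> is at most half of \<open>\<bar>l\<bar>\<close>; hence
    \<open>L \<le> 1\<close> and \<open>L\<^sup>2 \<le> 9 / 4 * l\<^sup>2\<close>.\<close>
  have l2: "l\<^sup>2 \<le> \<bar>l\<bar> / 8"
    unfolding power2_abs[of l, symmetric] power2_eq_square[of "\<bar>l\<bar>"] using mult_left_mono[OF l, of "\<bar>l\<bar>"] by simp
  have L: "L \<le> 3 / 2 * \<bar>l\<bar>" "L \<ge> 0" unfolding L_def using l2 by auto
  have L2: "L\<^sup>2 \<le> 3 * l\<^sup>2"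
  proof -
    have "L\<^sup>2 \<le> (3 / 2 * \<bar>l\<bar>)\<^sup>2" using L by (intro power_mono)
    also have "\<dots> = 9 / 4 * l\<^sup>2" by (simp add: power_mult_distrib power2_eq_square)
    also have "\<dots> \<le> 3 * l\<^sup>2" by simp
    finally show ?thesis .
  qed
  have g_diff: "\<bar>g (Suc k) - g k\<bar> \<le> L" for k
  proof (cases "Suc k \<le> n")
    case True
    have "g (Suc k) - g k = l * (e (Suc k) - e k) + 4 * l\<^sup>2"
      using True by (simp add: g_def algebra_simps)
    also have "\<bar>\<dots>\<bar> \<le> \<bar>l * (e (Suc k) - e k)\<bar> + \<bar>4 * l\<^sup>2\<bar>" by (rule abs_triangle_ineq)
    also have "\<dots> \<le> \<bar>l\<bar> * 1 + 4 * l\<^sup>2"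
      unfolding abs_mult[of l] using e_diff[OF True] by (intro add_mono mult_left_mono) auto
    finally show ?thesis by (simp add: L_def)
  next
    case False
    then have "min (Suc k) n = min k n" by simp
    then show ?thesis using L by (simp add: g_def)
  qed
  have "(\<Sum>S\<in>Pow V. w S * exp (l * f S)) = (\<Sum>k\<le>n. \<Sum>S\<in>slice V k {} {}. w S * exp (l * f S))"
    unfolding n_def by (rule sum_Pow_slices[OF V(1)])
  also have "\<dots> \<le> (\<Sum>k\<le>n. \<rho> k * exp (g k))"
  proof (rule sum_mono)
    fix k assume k: "k \<in> {..n}"
    have "(\<Sum>S\<in>slice V k {} {}. w S * exp (l * f S))
      \<le> sum w (slice V k {} {}) * exp (l * avg V k w f {} + 4 * l\<^sup>2 * (real k - real (card ({} :: 'a set))))"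
      by (rule homogeneous_mgf[OF nd V(1) lip]) (use k l in \<open>auto simp: n_def\<close>)
    then show "(\<Sum>S\<in>slice V k {} {}. w S * exp (l * f S)) \<le> \<rho> k * exp (g k)"
      using k by (simp add: \<rho>_def g_def e_def)
  qed
  also have "\<dots> = coeff_sum p (\<lambda>k. exp (g k))" by (rule cs[symmetric])
  also have "\<dots> \<le> poly p 1 * exp ((coeff_sum p g + L\<^sup>2 * coeff_sum p real) / poly p 1)"
    using real_rooted_mgf[OF roots Zpos] g_diff L l by auto
  also have "\<dots> \<le> poly p 1 * exp ((l * (\<Sum>S\<in>Pow V. w S * f S) + 7 * l\<^sup>2 * (\<Sum>S\<in>Pow V. w S * real (card S))) / poly p 1)"
  proof -
    define N where "N = (\<Sum>S\<in>Pow V. w S * real (card S))"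
    have N: "coeff_sum p real = N"
      unfolding cs N_def sum_Pow_slices[OF V(1)] n_def
      by (rule sum.cong) (auto simp: \<rho>_def slice_def sum_distrib_right)
    have "N \<ge> 0" unfolding N_def using w by (intro sum_nonneg mult_nonneg_nonneg) (auto simp: less_imp_le)
    have E: "(\<Sum>k\<le>n. \<rho> k * e k) = (\<Sum>S\<in>Pow V. w S * f S)"
      unfolding sum_Pow_slices[OF V(1)] n_def[symmetric]
    proof (rule sum.cong)
      fix k assume "k \<in> {..n}"
      then show "\<rho> k * e k = (\<Sum>S\<in>slice V k {} {}. w S * f S)"
        using \<rho>[of k] by (simp add: e_def avg_def \<rho>_def)
    qed simp
    have "coeff_sum p g = (\<Sum>k\<le>n. l * (\<rho> k * e k) + 4 * l\<^sup>2 * (\<rho> k * real k))"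
      unfolding cs by (rule sum.cong) (auto simp: g_def algebra_simps)
    also have "\<dots> = l * (\<Sum>k\<le>n. \<rho> k * e k) + 4 * l\<^sup>2 * coeff_sum p real"
      unfolding sum.distrib sum_distrib_left[symmetric] cs ..
    finally have "coeff_sum p g + L\<^sup>2 * coeff_sum p real = l * (\<Sum>S\<in>Pow V. w S * f S) + (4 * l\<^sup>2 + L\<^sup>2) * N"
      unfolding E N by (simp add: algebra_simps)
    also have "\<dots> \<le> l * (\<Sum>S\<in>Pow V. w S * f S) + 7 * l\<^sup>2 * N"
      using L2 \<open>N \<ge> 0\<close> by (intro add_left_mono mult_right_mono) auto
    finally show ?thesis
      unfolding N_def using Zpos by (intro mult_left_mono) (auto intro: divide_right_mono)
  qed
  finally show ?thesis by (simp only: Z)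
qed

text \<open>General stable weights are limits of strictly positive ones.\<close>

lemma stable_mgf:
  assumes V: "finite V" "v \<notin> V" and st: "stable_weight V w" and w: "\<And>S. S \<subseteq> V \<Longrightarrow> w S \<ge> 0"
    and w1: "sum w (Pow V) = 1" and lip: "lip V f" and l: "\<bar>l\<bar> \<le> 1 / 8"
  shows "(\<Sum>S\<in>Pow V. w S * exp (l * f S)) \<le>
    exp (l * (\<Sum>S\<in>Pow V. w S * f S) + 7 * l\<^sup>2 * (\<Sum>S\<in>Pow V. w S * real (card S)))"
proof -
  define W where "W \<epsilon> h = (\<Sum>S\<in>Pow V. noise V \<epsilon> w S * h S)" for \<epsilon> and h :: "'a set \<Rightarrow> real"
  have W0: "W 0 h = (\<Sum>S\<in>Pow V. w S * h S)" for h
    unfolding W_def by (rule sum.cong) (auto simp: noise_0[OF V(1)])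
  have lim: "((\<lambda>\<epsilon>. W \<epsilon> h) \<longlongrightarrow> W 0 h) (at_right 0)" for h
  proof -
    have "continuous_on UNIV (\<lambda>\<epsilon>. W \<epsilon> h)" unfolding W_def by (intro continuous_intros)
    then have "isCont (\<lambda>\<epsilon>. W \<epsilon> h) 0" by (simp add: continuous_on_eq_continuous_at)
    then show ?thesis unfolding isCont_def by (rule tendsto_within_subset) simp
  qed
  \<comment> \<open>The noisy weight is not normalized, so the total mass is carried through the
    limit and becomes 1 only at \<open>\<epsilon> = 0\<close>.\<close>
  have one: "W 0 (\<lambda>_. 1) = 1" using w1 by (simp add: W0)
  have "W 0 (\<lambda>S. exp (l * f S)) \<le> W 0 (\<lambda>_. 1) *
    exp ((l * W 0 f + 7 * l\<^sup>2 * W 0 (\<lambda>S. real (card S))) / W 0 (\<lambda>_. 1))"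
  proof (rule tendsto_le[of "at_right (0::real)"])
    show "((\<lambda>\<epsilon>. W \<epsilon> (\<lambda>_. 1) * exp ((l * W \<epsilon> f + 7 * l\<^sup>2 * W \<epsilon> (\<lambda>S. real (card S))) / W \<epsilon> (\<lambda>_. 1)))
      \<longlongrightarrow> W 0 (\<lambda>_. 1) * exp ((l * W 0 f + 7 * l\<^sup>2 * W 0 (\<lambda>S. real (card S))) / W 0 (\<lambda>_. 1))) (at_right 0)"
      by (intro tendsto_intros lim) (simp add: one)
    show "((\<lambda>\<epsilon>. W \<epsilon> (\<lambda>S. exp (l * f S))) \<longlongrightarrow> W 0 (\<lambda>S. exp (l * f S))) (at_right 0)" by (rule lim)
    have "\<forall>\<^sub>F \<epsilon> in at_right (0::real). 0 < \<epsilon> \<and> \<epsilon> < 1"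
      by (intro eventually_conj eventually_at_right_less) (auto simp: eventually_at_right_field intro!: exI[of _ 1])
    then show "\<forall>\<^sub>F \<epsilon> in at_right 0. W \<epsilon> (\<lambda>S. exp (l * f S)) \<le> W \<epsilon> (\<lambda>_. 1) *
      exp ((l * W \<epsilon> f + 7 * l\<^sup>2 * W \<epsilon> (\<lambda>S. real (card S))) / W \<epsilon> (\<lambda>_. 1))"
    proof eventually_elim
      case (elim \<epsilon>)
      have "noise V \<epsilon> w S > 0" for S by (rule noise_pos[OF V(1)]) (use elim w w1 in auto)
      from stable_mgf_pos[OF V stable_noise[OF V(1) st] this lip l] elim
      show ?case by (simp add: W_def)
    qed
  qed simp
  then show ?thesis unfolding one unfolding W0 by simp
qed


section \<open>Transfer to the cube and the tail bounds\<close>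

text \<open>Restricted to \<open>{1..n}\<close> because the points of \<open>cube n\<close> are
  extensional functions.\<close>

definition cube_point :: "nat \<Rightarrow> nat set \<Rightarrow> nat \<Rightarrow> nat" where
  "cube_point n S = (\<lambda>j\<in>{1..n}. if j \<in> S then 1 else 0)"

lemma bij_betw_cube_point: "bij_betw (cube_point n) (Pow {1..n}) (cube n)"
proof (rule bij_betwI[where g = "\<lambda>\<omega>. {j\<in>{1..n}. \<omega> j = 1}"])
  show "cube_point n \<in> Pow {1..n} \<rightarrow> cube n"
    by (auto simp: cube_point_def cube_def)
  show "(\<lambda>\<omega>. {j\<in>{1..n}. \<omega> j = 1}) \<in> cube n \<rightarrow> Pow {1..n}" by auto
  show "{j\<in>{1..n}. cube_point n S j = 1} = S" if "S \<in> Pow {1..n}" for S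
    using that by (auto simp: cube_point_def split: if_splits)
  show "cube_point n {j\<in>{1..n}. \<omega> j = 1} = \<omega>" if \<omega>: "\<omega> \<in> cube n" for \<omega>
  proof
    fix j
    show "cube_point n {j\<in>{1..n}. \<omega> j = 1} j = \<omega> j"
    proof (cases "j \<in> {1..n}")
      case True
      then have "\<omega> j \<in> {0, 1}" using \<omega> unfolding cube_def by (rule PiE_mem[rotated])
      then show ?thesis using True by (auto simp: cube_point_def)
    next
      case False
      then show ?thesis using PiE_arb[OF \<omega>[unfolded cube_def] False] by (auto simp: cube_point_def)
    qed
  qed
qed

lemma finite_cube: "finite (cube n)"
  unfolding cube_def by (intro finite_PiE) auto

lemma expectation_cube:
  fixes h :: "(nat \<Rightarrow> nat) \<Rightarrow> real"
  assumes "set_pmf P \<subseteq> cube n"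
  shows "measure_pmf.expectation P h = (\<Sum>S\<in>Pow {1..n}. pmf P (cube_point n S) * h (cube_point n S))"
proof -
  have "measure_pmf.expectation P h = (\<Sum>\<omega>\<in>cube n. pmf P \<omega> *\<^sub>R h \<omega>)"
    by (rule integral_measure_pmf[OF finite_cube]) (use assms in auto)
  also have "\<dots> = (\<Sum>S\<in>Pow {1..n}. pmf P (cube_point n S) *\<^sub>R h (cube_point n S))"
    by (rule sum.reindex_bij_betw[OF bij_betw_cube_point, symmetric])
  finally show ?thesis by simp
qed

lemma gen_poly_eq_set_poly: "gen_poly n P z = set_poly {1..n} (\<lambda>S. pmf P (cube_point n S)) z"
proof -
  have "gen_poly n P z = (\<Sum>S\<in>Pow {1..n}. complex_of_real (pmf P (cube_point n S)) * (\<Prod>j=1..n. z j ^ cube_point n S j))"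
    unfolding gen_poly_def by (rule sum.reindex_bij_betw[OF bij_betw_cube_point, symmetric])
  also have "\<dots> = set_poly {1..n} (\<lambda>S. pmf P (cube_point n S)) z"
    unfolding set_poly_def
  proof (intro sum.cong refl arg_cong2[where f = "(*)"])
    fix S assume S: "S \<in> Pow {1..n}"
    have "(\<Prod>j=1..n. z j ^ cube_point n S j) = (\<Prod>j\<in>{1..n}. if j \<in> S then z j else 1)"
      by (rule prod.cong) (auto simp: cube_point_def)
    also have "\<dots> = (\<Prod>j\<in>{1..n} \<inter> S. z j)" by (rule prod.inter_restrict[symmetric]) simp
    also have "{1..n} \<inter> S = S" using S by auto
    finally show "(\<Prod>j=1..n. z j ^ cube_point n S j) = (\<Prod>j\<in>S. z j)" .
  qed
  finally show ?thesis .
qed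

lemma lipschitz1_imp_lip:
  assumes "lipschitz1 n f"
  shows "lip {1..n} (\<lambda>S. f (cube_point n S))"
  unfolding lip_def
proof (intro allI impI ballI)
  fix S j assume S: "S \<subseteq> {1..n}" and j: "j \<in> {1..n} - S"
  have "cube_point n (insert j S) \<in> cube n" "cube_point n S \<in> cube n"
    using bij_betw_apply[OF bij_betw_cube_point] S j by auto
  moreover have "\<exists>!i. i \<in> {1..n} \<and> cube_point n (insert j S) i \<noteq> cube_point n S i"
    by (rule ex1I[of _ j]) (use j in \<open>auto simp: cube_point_def split: if_splits\<close>)
  ultimately show "\<bar>f (cube_point n (insert j S)) - f (cube_point n S)\<bar> \<le> 1"
    using assms unfolding lipschitz1_def by blast
qed

text \<open>Chernoff's method: the indicator of the tail event is bounded by an exponential, whose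
  mean is controlled by \<open>stable_mgf\<close>.\<close>

lemma strong_rayleigh_tail:
  assumes P: "set_pmf P \<subseteq> cube n" and sr: "strong_rayleigh n P" and lip: "lipschitz1 n f" and a: "a > 0"
    and \<mu>: "\<mu> = measure_pmf.expectation P (\<lambda>\<omega>. real (\<Sum>j=1..n. \<omega> j))"
  shows "measure_pmf.prob P {\<omega>. f \<omega> - measure_pmf.expectation P f > a} \<le> exp (- (a\<^sup>2 / (16 * (a + 2 * \<mu>))))"
proof -
  define V where "V = {1..n}"
  define w where "w S = pmf P (cube_point n S)" for S
  define F where "F S = f (cube_point n S)" for S
  define E where "E = measure_pmf.expectation P f"
  define A where "A = {\<omega>. f \<omega> - E > a}"
  \<comment> \<open>Since 0 is not an index, it can serve as the fresh element
    \<open>v\<close>.\<close>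
  have V: "finite V" "0 \<notin> V" by (auto simp: V_def)
  have ex: "measure_pmf.expectation P h = (\<Sum>S\<in>Pow V. w S * h (cube_point n S))" for h :: "_ \<Rightarrow> real"
    unfolding V_def w_def by (rule expectation_cube[OF P])
  have E: "E = (\<Sum>S\<in>Pow V. w S * F S)" unfolding E_def ex F_def ..
  have one: "sum w (Pow V) = 1" using ex[of "\<lambda>_. 1"] by simp
  have mu: "\<mu> = (\<Sum>S\<in>Pow V. w S * real (card S))"
    unfolding \<mu> ex
  proof (rule sum.cong)
    fix S assume S: "S \<in> Pow V"
    have "(\<Sum>j=1..n. cube_point n S j) = (\<Sum>j\<in>{1..n}. if j \<in> S then 1 else 0)"
      by (rule sum.cong) (auto simp: cube_point_def)
    also have "\<dots> = (\<Sum>j\<in>{1..n} \<inter> S. 1)" by (rule sum.inter_restrict[symmetric]) simp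
    also have "{1..n} \<inter> S = S" using S by (auto simp: V_def)
    finally show "w S * real (\<Sum>j=1..n. cube_point n S j) = w S * real (card S)" by simp
  qed simp
  have "\<mu> \<ge> 0" unfolding mu w_def by (intro sum_nonneg) auto
  define s where "s = a + 2 * \<mu>"
  have s: "s > 0" "a \<le> s" "2 * \<mu> \<le> s" using a \<open>\<mu> \<ge> 0\<close> by (auto simp: s_def)
  \<comment> \<open>As \<open>a \<le> s\<close>, this parameter is at most 1/8, the range of the
    exponential moment bound.\<close>
  define l where "l = a / (8 * s)"
  have l: "l > 0" "\<bar>l\<bar> \<le> 1 / 8" using s a by (auto simp: l_def field_simps)
  have st: "stable_weight V w"
    using sr unfolding strong_rayleigh_def stable_weight_def gen_poly_eq_set_poly V_def w_def by blast
  have mgf: "(\<Sum>S\<in>Pow V. w S * exp (l * F S)) \<le> exp (l * E + 7 * l\<^sup>2 * \<mu>)"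
    unfolding E mu using l lipschitz1_imp_lip[OF lip] one
    by (intro stable_mgf[OF V st]) (auto simp: w_def V_def F_def)
  have "measure_pmf.prob P A = measure_pmf.expectation P (indicator A)" by simp
  also have "\<dots> = (\<Sum>S\<in>Pow V. w S * indicator A (cube_point n S))" by (rule ex)
  also have "\<dots> \<le> (\<Sum>S\<in>Pow V. w S * (exp (l * F S) * exp (- l * (E + a))))"
  proof (intro sum_mono mult_left_mono)
    fix S
    show "indicator A (cube_point n S) \<le> exp (l * F S) * exp (- l * (E + a))"
    proof (cases "cube_point n S \<in> A")
      case True
      then have "l * (E + a) \<le> l * F S" using l by (intro mult_left_mono) (auto simp: A_def F_def)
      then have "1 \<le> exp (l * F S + - l * (E + a))" by simp
      then show ?thesis using True unfolding exp_add by simp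
    qed simp
  qed (simp add: w_def)
  also have "\<dots> = (\<Sum>S\<in>Pow V. w S * exp (l * F S)) * exp (- l * (E + a))"
    by (simp only: sum_distrib_right mult.assoc)
  also have "\<dots> \<le> exp (l * E + 7 * l\<^sup>2 * \<mu>) * exp (- l * (E + a))"
    by (rule mult_right_mono[OF mgf]) simp
  also have "\<dots> = exp (7 * l\<^sup>2 * \<mu> - l * a)"
    unfolding exp_add[symmetric] by (simp add: algebra_simps)
  \<comment> \<open>In units of \<open>a\<^sup>2 / s\<close> the quadratic term is at most 7/128,
    because \<open>2 * \<mu> \<le> s\<close>, and the linear term is 16/128; their difference -9/128
    is below -1/16.\<close>
  also have "\<dots> \<le> exp (- (a\<^sup>2 / (16 * s)))"
  proof -
    have "7 * l\<^sup>2 * \<mu> = (7 * l\<^sup>2 / 2) * (2 * \<mu>)" by simp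
    also have "\<dots> \<le> (7 * l\<^sup>2 / 2) * s" using s by (intro mult_left_mono) auto
    also have "\<dots> = 7 / 128 * (a\<^sup>2 / s)" using s by (simp add: l_def power2_eq_square field_simps)
    finally have "7 * l\<^sup>2 * \<mu> - l * a \<le> 7 / 128 * (a\<^sup>2 / s) - 1 / 8 * (a\<^sup>2 / s)"
      by (simp add: l_def power2_eq_square)
    also have "\<dots> \<le> - (1 / 16 * (a\<^sup>2 / s))" using s by (simp add: field_simps)
    finally show ?thesis by simp
  qed
  finally show ?thesis by (simp add: A_def E_def s_def)
qed

theorem theorem3p2:
  fixes n :: nat
    and P :: "(nat \<Rightarrow> nat) pmf"
    and N :: "(nat \<Rightarrow> nat) \<Rightarrow> nat"
    and f :: "(nat \<Rightarrow> nat) \<Rightarrow> real"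
    and \<mu> a :: real
  assumes "set_pmf P \<subseteq> cube n"
    and "strong_rayleigh n P"
    and "\<And>\<omega>. N \<omega> = (\<Sum>j=1..n. \<omega> j)"
    and "\<mu> = measure_pmf.expectation P (\<lambda>\<omega>. real (N \<omega>))"
    and "lipschitz1 n f"
    and "a > 0"
  shows "measure_pmf.prob P {\<omega>. f \<omega> - measure_pmf.expectation P f > a}
           \<le> 3 * exp (- (a\<^sup>2 / (16 * (a + 2 * \<mu>))))
      \<and> measure_pmf.prob P {\<omega>. \<bar>f \<omega> - measure_pmf.expectation P f\<bar> > a}
           \<le> 5 * exp (- (a\<^sup>2 / (16 * (a + 2 * \<mu>))))"
proof -
  let ?b = "exp (- (a\<^sup>2 / (16 * (a + 2 * \<mu>))))"
  let ?A = "{\<omega>. f \<omega> - measure_pmf.expectation P f > a}"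
  \<comment> \<open>The lower tail of \<open>f\<close> is the upper tail of \<open>- f\<close>,
    which is again Lipschitz-1.\<close>
  let ?B = "{\<omega>. - f \<omega> - measure_pmf.expectation P (\<lambda>\<omega>. - f \<omega>) > a}"
  have \<mu>: "\<mu> = measure_pmf.expectation P (\<lambda>\<omega>. real (\<Sum>j=1..n. \<omega> j))"
    using assms(3,4) by simp
  have neg: "lipschitz1 n (\<lambda>\<omega>. - f \<omega>)"
    using assms(5) unfolding lipschitz1_def by (auto simp: abs_minus_commute)
  have up: "measure_pmf.prob P ?A \<le> ?b"
    by (rule strong_rayleigh_tail[OF assms(1,2,5,6) \<mu>])
  have low: "measure_pmf.prob P ?B \<le> ?b"
    by (rule strong_rayleigh_tail[OF assms(1,2) neg assms(6) \<mu>])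
  have "{\<omega>. \<bar>f \<omega> - measure_pmf.expectation P f\<bar> > a} \<subseteq> ?A \<union> ?B" by auto
  then have "measure_pmf.prob P {\<omega>. \<bar>f \<omega> - measure_pmf.expectation P f\<bar> > a} \<le> measure_pmf.prob P (?A \<union> ?B)"
    by (intro measure_pmf.finite_measure_mono) auto
  also have "\<dots> \<le> measure_pmf.prob P ?A + measure_pmf.prob P ?B"
    by (rule measure_Un_le) auto
  also have "\<dots> \<le> 5 * ?b" using up low exp_gt_zero[of "- (a\<^sup>2 / (16 * (a + 2 * \<mu>)))"] by linarith
  finally show ?thesis using up exp_gt_zero[of "- (a\<^sup>2 / (16 * (a + 2 * \<mu>)))"] by linarith
qed

end
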